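(* Let $n\ge 2$ and let $a_0,\dots,a_n\in\mathbb{C}^*$ be distinct. Consider the quadric $\sum_{j=0}^n\frac{(x_j)^2}{a_j}=1$ in $\mathbb{C}^{n+1}$ parameterized with the conjugate system $(u^1,\dots,u^n)\subset\mathbb{C}^n$ given by the spherical coordinates on the unit sphere $\mathbb{S}^n\subset\mathbb{C}^{n+1}$: $$\mathcal{X}=\sqrt{a_0}\,\mathbf{C}_0e_0+\sum_{k=1}^n\sqrt{a_k}\,\mathbf{C}_k\sin(u^k)e_k,\qquad \mathbf{C}_k:=\prod_{j=k+1}^n\cos(u^j),$$ and the sub-manifold of $\mathbb{C}^{2n-1}$ $$\mathcal{X}_{\mathbf{z}}=\sum_{k=1}^{n-1}\mathbf{C}_kf_k\big(\cos(g_k)e_{2k-2}+\sin(g_k)e_{2k-1}\big)+h\,e_{2n-2}$$ depending on the parameters $\mathbf{z}=(z_1,\dots,z_{n-1})\in\mathbb{C}^{n-1}$, where $z_0:=1$ and, for $k=1,\dots,n-1$, $$f_k=f_k(z_{k-1},z_k,u^k):=\sqrt{(z_{k-1}-z_k)a_0+(a_k-z_{k-1}a_0)\sin^2(u^k)},$$ $$g_k=g_k(z_{k-1},z_k,u^k):=\int_0^{u^k}\frac{\sqrt{(z_{k-1}-z_k)a_0a_k+(a_k-z_{k-1}a_0)z_ka_0\sin^2(t)}}{(z_{k-1}-z_k)a_0+(a_k-z_{k-1}a_0)\sin^2(t)}\,dt,$$ $$h=h(z_{n-1},u^n):=\int_0^{u^n}\sqrt{a_n-(a_n-z_{n-1}a_0)\sin^2(t)}\,dt.$$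 Then: 1. $\mathcal{X}$ and $\mathcal{X}_{\mathbf{z}}$ have the same linear element: $|d\mathcal{X}|^2=|d\mathcal{X}_{\mathbf{z}}|^2$. 2. For $z_1=\dots=z_{n-1}=0$ one gets $g_2=\dots=g_{n-1}=0$ and $\mathcal{X}=\mathcal{X}_{\mathbf{0}}$, with $\mathbb{C}^{n+1}\hookrightarrow\mathbb{C}^{2n-1}$ as $(x_0,x_1,\dots,x_n)\mapsto(x_0,x_1,x_2,0,x_3,0,\dots,x_{n-1},0,x_n)$. 3. For $z_1=\dots=z_{n-1}=1$ one gets $\mathcal{X}_{\mathbf{1}}=(\mathbf{x}_0,\dots,\mathbf{x}_{2n-2})$ given by Peterson's formulae (modulo a sign in the second one) $$\sqrt{(\mathbf{x}_{2k-2})^2+(\mathbf{x}_{2k-1})^2}=\sqrt{a_k-a_0}\,\mathbf{C}_k\sin(u^k),\qquad \tan^{-1}\!\Big(\frac{\mathbf{x}_{2k-1}}{\mathbf{x}_{2k-2}}\Big)=\frac{\sqrt{a_0}}{\sqrt{a_k-a_0}}\tanh^{-1}\big(\cos(u^k)\big),\qquad k=1,\dots,n-1,$$ $$\mathbf{x}_{2n-2}=\int_0^{u^n}\sqrt{a_n-(a_n-a_0)\sin^2(t)}\,dt.$$ 4. Moreover $(u^1,\dots,u^n)$ form a conjugate system on $\mathcal{X}_{\mathbf{z}}$ with non-degenerate joined second fundamental forms; that is, for $N$ a normal field of $\mathcal{X}$ and $N_{\mathbf{z}}=[N_1\ \cdots\ N_{n-1}]$ a normal frame of $\mathcal{X}_{\mathbf{z}}$,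 $[d^2\mathcal{X}^TN\ \ d^2\mathcal{X}_{\mathbf{z}}^TN_{\mathbf{z}}]$ is a symmetric quadratic $\mathbb{C}^n$-valued form which contains only $(du^j)^2$ terms, and the dimension $n$ cannot be lowered for $\mathbf{z}$ in an open dense set.
   Context: On $\mathbb{C}^m$ use the complex bilinear form $\langle x,y\rangle=x^Ty$ and $|x|^2=x^Tx$ (no complex conjugation); $|d\mathcal{X}|^2$ is the induced linear element (first fundamental form) in the coordinates $(u^1,\dots,u^n)$, and $d^2$ is the tensorial (symmetric) second derivative. The $e_j$ denote the standard basis vectors, $e_0,\dots,e_n$ of $\mathbb{C}^{n+1}$ and $e_0,\dots,e_{2n-2}$ of $\mathbb{C}^{2n-1}$; the empty product gives $\mathbf{C}_n=1$. All computations are local and assumed valid on their open domain of validity; all functions have the needed order of differentiability and are assumed to be invertible, non-zero, etc. when required (for practical purposes, analytic). Simplifications $\sqrt{a}\sqrt{b}\simeq\sqrt{ab}$ are allowed; the possible signs are accounted for by symmetries in the principal planes for quadrics and disappear at the level of the linear element for their deformations. Conjugate system: coordinates $(u^1,\dots,u^n)$ on a sub-manifold such that its second fundamental form has no mixed terms $du^j\odot du^k$, $j\ne k$. The "dimension $n$ cannot be lowered" refers to the values of the $\mathbb{C}^n$-valued form $\sum_jh_j(du^j)^2$, i.e. the vectors $h_1,\dots,h_n\in\mathbb{C}^n$ are linearly independent.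
   Formalization: For z=(1,…,1) the integral g_k from 0 diverges, so its lower limit is a parameter b_k; Peterson's second formula holds up to an additive constant, zero for b_k=π/2. X=X_0 holds up to root signs. Independence in part 4 is claimed where the linear element is non-degenerate. *)

theory Defs
  imports "HOL-Complex_Analysis.Complex_Analysis"
begin

text \<open>
  Points and vectors of \<open>\<complex>\<^sup>m\<close> are functions \<open>nat \<Rightarrow> complex\<close> of which only the relevant
  entries are used: indices \<open>1..n\<close> for the coordinates \<open>(u\<^sup>1, \<dots>, u\<^sup>n)\<close>, indices \<open>0..<m\<close>
  for the ambient spaces. All products are the complex bilinear ones (no conjugation).
\<close>

type_synonym cvec = "nat \<Rightarrow> complex"

definition lin_indep :: "nat set \<Rightarrow> nat set \<Rightarrow> (nat \<Rightarrow> cvec) \<Rightarrow> bool" where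
  \<comment> \<open>the family \<open>V j\<close> (\<open>j \<in> J\<close>) of vectors with entries indexed by \<open>I\<close>\<close>
  "lin_indep J I V \<longleftrightarrow>
     (\<forall>c. (\<forall>i\<in>I. (\<Sum>j\<in>J. c j * V j i) = 0) \<longrightarrow> (\<forall>j\<in>J. c j = 0))"

definition pd :: "nat \<Rightarrow> (cvec \<Rightarrow> complex) \<Rightarrow> cvec \<Rightarrow> complex" where
  "pd j F u = deriv (\<lambda>t. F (u(j := t))) (u j)"

definition tangent :: "(cvec \<Rightarrow> cvec) \<Rightarrow> cvec \<Rightarrow> nat \<Rightarrow> cvec" where
  "tangent F u j l = pd j (\<lambda>w. F w l) u"

definition lin_element :: "nat \<Rightarrow> nat \<Rightarrow> (cvec \<Rightarrow> cvec) \<Rightarrow> cvec \<Rightarrow> cvec \<Rightarrow> complex" where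
  \<comment> \<open>the quadratic form \<open>|dF|\<^sup>2\<close> at \<open>u\<close>, evaluated at \<open>(du\<^sup>1, \<dots>, du\<^sup>n) = v\<close>\<close>
  "lin_element m n F u v = (\<Sum>l<m. (\<Sum>j=1..n. tangent F u j l * v j)\<^sup>2)"

definition gram :: "nat \<Rightarrow> (cvec \<Rightarrow> cvec) \<Rightarrow> cvec \<Rightarrow> nat \<Rightarrow> nat \<Rightarrow> complex" where
  "gram m F u i j = (\<Sum>l<m. tangent F u i l * tangent F u j l)"

definition immersed_at :: "nat \<Rightarrow> nat \<Rightarrow> (cvec \<Rightarrow> cvec) \<Rightarrow> cvec \<Rightarrow> bool" where
  "immersed_at m n F u \<longleftrightarrow> lin_indep {1..n} {..<m} (tangent F u)"

text \<open>The bilinear form may degenerate on a complex tangent space, even of an immersion.\<close>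

definition nondegenerate_metric_at :: "nat \<Rightarrow> nat \<Rightarrow> (cvec \<Rightarrow> cvec) \<Rightarrow> cvec \<Rightarrow> bool" where
  "nondegenerate_metric_at m n F u \<longleftrightarrow> lin_indep {1..n} {1..n} (gram m F u)"

definition normal_at :: "nat \<Rightarrow> nat \<Rightarrow> (cvec \<Rightarrow> cvec) \<Rightarrow> cvec \<Rightarrow> cvec \<Rightarrow> bool" where
  "normal_at m n F u N \<longleftrightarrow> (\<forall>j\<in>{1..n}. (\<Sum>l<m. N l * tangent F u j l) = 0)"

text \<open>
  Coefficient of \<open>du\<^sup>i du\<^sup>j\<close> in \<open>(d\<^sup>2F)\<^sup>T N\<close>. For normal \<open>N\<close> the Christoffel terms of the
  tensorial second derivative, being tangential, drop out.
\<close>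

definition second_form :: "nat \<Rightarrow> (cvec \<Rightarrow> cvec) \<Rightarrow> cvec \<Rightarrow> cvec \<Rightarrow> nat \<Rightarrow> nat \<Rightarrow> complex" where
  "second_form m F u N i j = (\<Sum>l<m. pd i (pd j (\<lambda>w. F w l)) u * N l)"

text \<open>
  \<open>normal_data\<close>: at \<open>u\<close>, a non-zero normal \<open>N\<close> of \<open>X\<close> in \<open>\<complex>\<^sup>n\<^sup>+\<^sup>1\<close> and a normal frame
  \<open>[N\<^sub>1 \<dots> N\<^sub>n\<^sub>-\<^sub>1]\<close> of \<open>Y\<close> in \<open>\<complex>\<^sup>2\<^sup>n\<^sup>-\<^sup>1\<close>. \<open>joined_form\<close>: the coefficient of
  \<open>du\<^sup>i du\<^sup>j\<close> in \<open>[d\<^sup>2X\<^sup>T N, d\<^sup>2Y\<^sup>T [N\<^sub>1 \<dots> N\<^sub>n\<^sub>-\<^sub>1]]\<close>, a vector of \<open>\<complex>\<^sup>n\<close> with entries \<open>0..<n\<close>.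
\<close>

definition normal_data ::
  "nat \<Rightarrow> (cvec \<Rightarrow> cvec) \<Rightarrow> (cvec \<Rightarrow> cvec) \<Rightarrow> cvec \<Rightarrow> cvec \<Rightarrow> (nat \<Rightarrow> cvec) \<Rightarrow> bool" where
  "normal_data n X Y u N NY \<longleftrightarrow>
     normal_at (n + 1) n X u N \<and> (\<exists>l<n + 1. N l \<noteq> 0) \<and>
     (\<forall>k\<in>{1..<n}. normal_at (2 * n - 1) n Y u (NY k)) \<and>
     lin_indep {1..<n} {..<2 * n - 1} NY"

definition joined_form ::
  "nat \<Rightarrow> (cvec \<Rightarrow> cvec) \<Rightarrow> (cvec \<Rightarrow> cvec) \<Rightarrow> cvec \<Rightarrow> cvec \<Rightarrow> (nat \<Rightarrow> cvec) \<Rightarrow> nat \<Rightarrow> nat \<Rightarrow> cvec" where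
  "joined_form n X Y u N NY i j k =
     (if k = 0 then second_form (n + 1) X u N i j
      else second_form (2 * n - 1) Y u (NY k) i j)"

definition cos_prod :: "nat \<Rightarrow> nat \<Rightarrow> cvec \<Rightarrow> complex" where
  "cos_prod n k u = (\<Prod>j=k+1..n. cos (u j))"

text \<open>\<open>s j\<close> is the chosen square root of \<open>a j\<close>.\<close>

definition quadric :: "nat \<Rightarrow> cvec \<Rightarrow> cvec \<Rightarrow> cvec" where
  "quadric n s u l =
     (if l = 0 then s 0 * cos_prod n 0 u else s l * cos_prod n l u * sin (u l))"

definition par :: "cvec \<Rightarrow> cvec" where
  "par z k = (if k = 0 then 1 else z k)"

definition f_radicand :: "cvec \<Rightarrow> cvec \<Rightarrow> nat \<Rightarrow> complex \<Rightarrow> complex" where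
  "f_radicand a z k t =
     (par z (k - 1) - par z k) * a 0 + (a k - par z (k - 1) * a 0) * (sin t)\<^sup>2"

definition g_radicand :: "cvec \<Rightarrow> cvec \<Rightarrow> nat \<Rightarrow> complex \<Rightarrow> complex" where
  "g_radicand a z k t =
     (par z (k - 1) - par z k) * a 0 * a k
       + (a k - par z (k - 1) * a 0) * par z k * a 0 * (sin t)\<^sup>2"

definition h_radicand :: "nat \<Rightarrow> cvec \<Rightarrow> cvec \<Rightarrow> complex \<Rightarrow> complex" where
  "h_radicand n a z t = a n - (a n - par z (n - 1) * a 0) * (sin t)\<^sup>2"

definition sqrt_branch :: "complex set \<Rightarrow> (complex \<Rightarrow> complex) \<Rightarrow> (complex \<Rightarrow> complex) \<Rightarrow> bool" where
  "sqrt_branch D \<phi> r \<longleftrightarrow> r holomorphic_on D \<and> (\<forall>t\<in>D. (r t)\<^sup>2 = \<phi> t)"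

text \<open>\<open>G u = \<integral>\<^sub>b\<^sup>u \<phi>(t) dt\<close> for \<open>u \<in> D\<close>, the integral being independent of the path in \<open>D\<close>.\<close>

definition integral_from ::
  "complex \<Rightarrow> complex set \<Rightarrow> (complex \<Rightarrow> complex) \<Rightarrow> (complex \<Rightarrow> complex) \<Rightarrow> bool" where
  "integral_from b D \<phi> G \<longleftrightarrow>
     b \<in> D \<and> \<phi> holomorphic_on D \<and>
     (\<forall>p. valid_path p \<and> path_image p \<subseteq> D \<and> pathstart p = b \<longrightarrow>
        (\<phi> has_contour_integral G (pathfinish p)) p)"

text \<open>
  A choice of branches for the deformation with parameters \<open>z\<close>: domains \<open>D k\<close> for the
  coordinates \<open>u\<^sup>k\<close>, branches \<open>f k\<close>, branches \<open>r k\<close> of the roots under the integral signs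
  (\<open>r n\<close> for \<open>h\<close>), and the integrals \<open>g k\<close> and \<open>h\<close>. The lower limit of integration of \<open>g k\<close>
  is a parameter \<open>b k\<close>: it is \<open>0\<close> whenever the integral from \<open>0\<close> exists, but the integrand has
  a simple pole at \<open>0\<close> if \<open>z\<^sub>k\<^sub>-\<^sub>1 = z\<^sub>k \<noteq> 0\<close>, in particular for \<open>z = (1, \<dots>, 1)\<close>.
  If \<open>z\<^sub>k\<^sub>-\<^sub>1 = z\<^sub>k = 0\<close>, the integrand is identically zero, also (as \<open>0 / 0 = 0\<close>) at the zeros
  of \<open>sin\<close>.
\<close>

definition branches ::
  "nat \<Rightarrow> cvec \<Rightarrow> cvec \<Rightarrow> cvec \<Rightarrow> (nat \<Rightarrow> complex set) \<Rightarrow> (nat \<Rightarrow> complex \<Rightarrow> complex) \<Rightarrow>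
   (nat \<Rightarrow> complex \<Rightarrow> complex) \<Rightarrow> (nat \<Rightarrow> complex \<Rightarrow> complex) \<Rightarrow> (complex \<Rightarrow> complex) \<Rightarrow> bool" where
  "branches n a z b D f r g h \<longleftrightarrow>
     (\<forall>k\<in>{1..n}. open (D k) \<and> connected (D k)) \<and>
     (\<forall>k\<in>{1..<n}.
        sqrt_branch (D k) (f_radicand a z k) (f k) \<and>
        sqrt_branch (D k) (g_radicand a z k) (r k) \<and>
        integral_from (b k) (D k) (\<lambda>t. r k t / f_radicand a z k t) (g k)) \<and>
     sqrt_branch (D n) (h_radicand n a z) (r n) \<and>
     integral_from 0 (D n) (r n) h"

definition valid_domain ::
  "nat \<Rightarrow> (nat \<Rightarrow> complex set) \<Rightarrow> (nat \<Rightarrow> complex \<Rightarrow> complex) \<Rightarrow> cvec set" where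
  "valid_domain n D f =
     {u. (\<forall>k\<in>{1..n}. u k \<in> D k) \<and> (\<forall>k\<in>{1..<n}. f k (u k) \<noteq> 0)}"

text \<open>Entries \<open>2k-2\<close>, \<open>2k-1\<close> (\<open>1 \<le> k < n\<close>) form the \<open>k\<close>-th plane; the last entry is \<open>2n-2\<close>.\<close>

definition deformation ::
  "nat \<Rightarrow> (nat \<Rightarrow> complex \<Rightarrow> complex) \<Rightarrow> (nat \<Rightarrow> complex \<Rightarrow> complex) \<Rightarrow> (complex \<Rightarrow> complex) \<Rightarrow>
   cvec \<Rightarrow> cvec" where
  "deformation n f g h u l =
     (if l = 2 * n - 2 then h (u n)
      else let k = l div 2 + 1 in
        cos_prod n k u * f k (u k) * (if even l then cos (g k (u k)) else sin (g k (u k))))"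

text \<open>\<open>(x\<^sub>0, x\<^sub>1, \<dots>, x\<^sub>n) \<mapsto> (x\<^sub>0, x\<^sub>1, x\<^sub>2, 0, x\<^sub>3, 0, \<dots>, x\<^sub>n\<^sub>-\<^sub>1, 0, x\<^sub>n)\<close>\<close>

definition quadric_embed :: "cvec \<Rightarrow> cvec" where
  "quadric_embed x l = (if l \<le> 1 then x l else if even l then x (l div 2 + 1) else 0)"

definition param_space :: "nat \<Rightarrow> cvec topology" where
  "param_space n = product_topology (\<lambda>_. euclidean) {1..<n}"

end

theory Submission
  imports Defs "Jordan_Normal_Form.Determinant"
begin

text \<open>
  Both the quadric and its deformation are built level by level: every component has the form
  \<open>C\<^sub>k(u) \<phi>(u\<^sup>k)\<close> with \<open>C\<^sub>k\<close> the product of the cosines of the later coordinates. For the metric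
  only two functions per level matter, the squared radius \<open>\<Sum> \<phi>\<^sup>2\<close> and the squared speed
  \<open>\<Sum> \<phi>'\<^sup>2\<close>, summed over the components of that level. With \<open>A\<^sub>k = z\<^sub>k a\<^sub>0\<close> they are
  \<open>a\<^sub>k sin\<^sup>2 + A\<^sub>k\<^sub>-\<^sub>1 cos\<^sup>2 - A\<^sub>k\<close> and \<open>a\<^sub>k cos\<^sup>2 + A\<^sub>k\<^sub>-\<^sub>1 sin\<^sup>2\<close> for the deformation, and the same with
  \<open>A\<^sub>0 = a\<^sub>0\<close> and all other \<open>A\<^sub>k = 0\<close> for the quadric; the functions \<open>f\<^sub>k\<close>, \<open>g\<^sub>k\<close>, \<open>h\<close> are the
  polar coordinates that realize this profile in a plane. Because \<open>C\<^sub>k\<^sub>-\<^sub>1 = C\<^sub>k cos u\<^sup>k\<close>, level \<open>k\<close>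
  contributes \<open>a\<^sub>k (d(C\<^sub>k sin u\<^sup>k))\<^sup>2 + A\<^sub>k\<^sub>-\<^sub>1 (dC\<^sub>k\<^sub>-\<^sub>1)\<^sup>2 - A\<^sub>k (dC\<^sub>k)\<^sup>2\<close>, so the sum telescopes and
  depends on \<open>A\<close> only through \<open>A\<^sub>0 = a\<^sub>0\<close>. Hence the isometry (\<open>metric_eq\<close>).

  The coordinates are conjugate because components are products of functions of one coordinate
  each: for \<open>i < j\<close> a component that depends on \<open>u\<^sup>i\<close> at all depends on \<open>u\<^sup>j\<close> through the factor
  \<open>cos u\<^sup>j\<close>, so \<open>\<partial>\<^sub>i\<partial>\<^sub>j F = - tan u\<^sup>j \<partial>\<^sub>i F\<close> is tangent (\<open>mixed_second_derivative\<close>).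

  For the independence, let the vectors of the joined forms satisfy a linear relation with
  coefficients \<open>c\<close>. Then \<open>\<Sum> c\<^sub>j \<partial>\<^sub>j\<^sup>2 F\<close> is tangent for both maps. The inner products with the
  coordinate fields telescope just like the metric (\<open>tangential_second_eq\<close>), so for one and
  the same \<open>t\<close> the operator \<open>L = \<Sum> (c\<^sub>j \<partial>\<^sub>j\<^sup>2 - t\<^sub>j \<partial>\<^sub>j)\<close> annihilates the components of both maps.
  On the quadric this says \<open>L C\<^sub>0 = 0\<close> and \<open>L (C\<^sub>k sin u\<^sup>k) = 0\<close>; on the deformation the radial
  part of level \<open>k\<close> then becomes \<open>A\<^sub>k L C\<^sub>k = A\<^sub>k\<^sub>-\<^sub>1 cos u\<^sup>k L C\<^sub>k\<^sub>-\<^sub>1\<close>. If no \<open>z\<^sub>k\<close> vanishes, all \<open>L C\<^sub>k\<close>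
  vanish, and this forces \<open>c = 0\<close> (\<open>joined_form_nondegenerate\<close>). The open dense set of
  parameters is therefore \<open>z\<^sub>1 \<dots> z\<^sub>n\<^sub>-\<^sub>1 \<noteq> 0\<close>.

  For \<open>z = 0\<close> the planes with \<open>k \<ge> 2\<close> carry \<open>f\<^sub>k = \<plusminus>\<surd>a\<^sub>k sin\<close> and no rotation, and the first one
  carries the polar coordinates of an ellipse (\<open>ellipse_polar_coordinates\<close>). For \<open>z = 1\<close> the
  angle is a primitive of a multiple of \<open>1 / sin\<close>, that is of \<open>tanh\<^sup>-\<^sup>1 (cos u\<^sup>k)\<close>
  (\<open>unit_parameters_angle\<close>).
\<close>

section \<open>Square linear systems and frames\<close>

text \<open>
  An independent family of as many vectors as there are entries is the set of columns of an
  invertible matrix; numbering both index sets turns the claim into a statement on determinants.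
\<close>

lemma lin_indep_square_solve:
  assumes "finite J" "finite I" "card J = card I" and indep: "lin_indep J I V"
  shows "\<exists>c. \<forall>i\<in>I. (\<Sum>j\<in>J. c j * V j i) = y i"
proof -
  define m where "m = card I"
  obtain p where p: "bij_betw p {..<m} J"
    using assms(1,3) finite_same_card_bij[of "{..<m}" J] by (auto simp: m_def)
  obtain q where q: "bij_betw q {..<m} I"
    using assms(2) finite_same_card_bij[of "{..<m}" I] by (auto simp: m_def)
  define A where "A = mat m m (\<lambda>(i, j). V (p j) (q i))"
  have A: "A \<in> carrier_mat m m" by (simp add: A_def)
  have q_on: "q i \<in> I" if "i < m" for i using q that by (auto simp: bij_betw_def)
  have row: "(A *\<^sub>v w) $ i = (\<Sum>j\<in>J. w $ (inv_into {..<m} p j) * V j (q i))"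
    if "w \<in> carrier_vec m" "i < m" for w i
  proof -
    have "(A *\<^sub>v w) $ i = (\<Sum>j<m. w $ j * V (p j) (q i))"
      using that by (auto simp: A_def scalar_prod_def lessThan_atLeast0 mult.commute intro!: sum.cong)
    also have "\<dots> = (\<Sum>j<m. w $ (inv_into {..<m} p (p j)) * V (p j) (q i))"
      using p by (intro sum.cong) (auto simp: bij_betw_def inv_into_f_f)
    also have "\<dots> = (\<Sum>j\<in>J. w $ (inv_into {..<m} p j) * V j (q i))"
      using p by (rule sum.reindex_bij_betw)
    finally show ?thesis .
  qed
  have "det A \<noteq> 0"
  proof
    assume "det A = 0"
    then obtain w where w: "w \<in> carrier_vec m" "w \<noteq> 0\<^sub>v m" "A *\<^sub>v w = 0\<^sub>v m"
      using det_0_iff_vec_prod_zero[OF A] by blast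
    have "(\<Sum>j\<in>J. w $ (inv_into {..<m} p j) * V j i) = 0" if i: "i \<in> I" for i
    proof -
      from i q obtain i' where "i' < m" "i = q i'" by (auto simp: bij_betw_def)
      then show ?thesis using row[OF w(1), of i'] w(3) by simp
    qed
    then have zero: "\<forall>j\<in>J. w $ (inv_into {..<m} p j) = 0"
      using indep[unfolded lin_indep_def, rule_format, of "\<lambda>j. w $ (inv_into {..<m} p j)"] by simp
    have "w $ j = 0" if "j < m" for j
    proof -
      have "p j \<in> J" "inv_into {..<m} p (p j) = j"
        using p that by (auto simp: bij_betw_def inv_into_f_f)
      then show ?thesis using zero by metis
    qed
    then show False using w(1,2) by auto
  qed
  from det_non_zero_imp_unit[OF A this] obtain B
    where B: "B \<in> carrier_mat m m" and AB: "A * B = 1\<^sub>m m"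
    by (auto simp: Units_def ring_mat_def)
  define w where "w = B *\<^sub>v vec m (\<lambda>i. y (q i))"
  have w: "w \<in> carrier_vec m" using B by (simp add: w_def)
  have Aw: "A *\<^sub>v w = vec m (\<lambda>i. y (q i))"
    unfolding w_def using A B AB by (simp add: assoc_mult_mat_vec[symmetric, of _ m m _ m])
  have "(\<Sum>j\<in>J. w $ (inv_into {..<m} p j) * V j i) = y i" if i: "i \<in> I" for i
  proof -
    from i q obtain i' where "i' < m" "i = q i'" by (auto simp: bij_betw_def)
    then show ?thesis using row[OF w, of i'] Aw by simp
  qed
  then show ?thesis by (intro exI[of _ "\<lambda>j. w $ (inv_into {..<m} p j)"]) blast
qed

text \<open>
  Expanding the \<open>i\<close>-th unit vector in the basis \<open>V\<close> shows that the \<open>i\<close>-th entry of a vector orthogonal to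
  the basis is \<open>0\<close>.
\<close>

lemma lin_indep_square_orthogonal:
  assumes fin: "finite J" "finite I" "card J = card I" and indep: "lin_indep J I V"
    and orth: "\<And>j. j \<in> J \<Longrightarrow> (\<Sum>i\<in>I. x i * V j i) = 0" and i: "i \<in> I"
  shows "x i = 0"
proof -
  obtain c where c: "\<forall>k\<in>I. (\<Sum>j\<in>J. c j * V j k) = (if k = i then 1 else 0)"
    using lin_indep_square_solve[OF fin indep, of "\<lambda>k. if k = i then 1 else 0"] by blast
  have "x i = (\<Sum>k\<in>I. if k = i then x k else 0)" using i fin(2) by simp
  also have "\<dots> = (\<Sum>k\<in>I. x k * (\<Sum>j\<in>J. c j * V j k))"
    using c by (intro sum.cong) auto
  also have "\<dots> = (\<Sum>k\<in>I. \<Sum>j\<in>J. c j * (x k * V j k))"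
    by (simp add: sum_distrib_left algebra_simps)
  also have "\<dots> = (\<Sum>j\<in>J. c j * (\<Sum>k\<in>I. x k * V j k))"
    by (subst sum.swap) (simp add: sum_distrib_left)
  also have "\<dots> = 0" using orth by simp
  finally show ?thesis .
qed

text \<open>
  When the metric is non-degenerate, tangent vectors and a normal frame are jointly
  independent: the Gram matrix detects the tangential part of a relation, which leaves a relation
  between normals. So they form a basis, and only the zero vector is orthogonal to it.
\<close>

lemma frame_orthogonal_zero:
  assumes metric: "nondegenerate_metric_at m n F u" and m: "m = n + p"
    and normal: "\<And>k. k \<in> {1..p} \<Longrightarrow> normal_at m n F u (M k)"
    and indep: "lin_indep {1..p} {..<m} M"
    and V_tangent: "\<And>j. j \<in> {1..n} \<Longrightarrow> (\<Sum>l<m. V l * tangent F u j l) = 0"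
    and V_normal: "\<And>k. k \<in> {1..p} \<Longrightarrow> (\<Sum>l<m. V l * M k l) = 0"
    and l: "l < m"
  shows "V l = 0"
proof -
  define W where "W j = (if j \<le> n then tangent F u j else M (j - n))" for j
  have split: "(\<Sum>j=1..m. X j) = (\<Sum>j=1..n. X j) + (\<Sum>k=1..p. X (n + k))" for X :: "nat \<Rightarrow> complex"
  proof -
    have "{1..m} = {1..n} \<union> {n + 1..n + p}" unfolding m by auto
    then have "(\<Sum>j=1..m. X j) = (\<Sum>j=1..n. X j) + (\<Sum>j=n+1..n+p. X j)"
      by (simp add: sum.union_disjoint)
    moreover have "(\<Sum>j=n+1..n+p. X j) = (\<Sum>k=1..p. X (n + k))"
      using sum.shift_bounds_cl_nat_ivl[of X 1 n p] by (simp add: add.commute)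
    ultimately show ?thesis by simp
  qed
  have "lin_indep {1..m} {..<m} W"
    unfolding lin_indep_def
  proof (intro allI impI)
    fix c assume c: "\<forall>i\<in>{..<m}. (\<Sum>j=1..m. c j * W j i) = 0"
    have c': "(\<Sum>j=1..n. c j * tangent F u j i) + (\<Sum>k=1..p. c (n + k) * M k i) = 0" if "i < m" for i
    proof -
      have "(\<Sum>k=1..p. c (n + k) * W (n + k) i) = (\<Sum>k=1..p. c (n + k) * M k i)"
        by (intro sum.cong) (auto simp: W_def)
      moreover have "(\<Sum>j=1..n. c j * W j i) = (\<Sum>j=1..n. c j * tangent F u j i)"
        by (intro sum.cong) (auto simp: W_def)
      ultimately show ?thesis using c that split[of "\<lambda>j. c j * W j i"] by simp
    qed
    have "(\<Sum>j=1..n. c j * gram m F u j i) = 0" if i: "i \<in> {1..n}" for i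
    proof -
      have "(\<Sum>k=1..p. c (n + k) * (\<Sum>l<m. M k l * tangent F u i l)) = 0"
        using normal i by (intro sum.neutral) (auto simp: normal_at_def)
      then have "(\<Sum>j=1..n. c j * gram m F u j i) =
          (\<Sum>j=1..n. c j * (\<Sum>l<m. tangent F u j l * tangent F u i l)) +
          (\<Sum>k=1..p. c (n + k) * (\<Sum>l<m. M k l * tangent F u i l))"
        by (simp add: gram_def)
      also have "\<dots> = (\<Sum>l<m. ((\<Sum>j=1..n. c j * tangent F u j l) + (\<Sum>k=1..p. c (n + k) * M k l))
                           * tangent F u i l)"
        unfolding distrib_right sum.distrib sum_distrib_right sum_distrib_left
        by (subst (2 4) sum.swap) (simp add: mult.assoc)
      also have "\<dots> = 0" using c' by (intro sum.neutral) auto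
      finally show ?thesis .
    qed
    then have c1: "\<forall>j\<in>{1..n}. c j = 0"
      using metric unfolding nondegenerate_metric_at_def lin_indep_def by blast
    have "(\<Sum>k=1..p. c (n + k) * M k i) = 0" if "i < m" for i
      using c'[OF that] c1 by simp
    then have c2: "\<forall>k\<in>{1..p}. c (n + k) = 0"
      using indep[unfolded lin_indep_def, rule_format, of "\<lambda>k. c (n + k)"] by auto
    show "\<forall>j\<in>{1..m}. c j = 0"
    proof
      fix j assume j: "j \<in> {1..m}"
      show "c j = 0"
      proof (cases "j \<le> n")
        case False
        then have "j = n + (j - n)" "j - n \<in> {1..p}" using j m by auto
        then show ?thesis using c2 by metis
      qed (use c1 j in auto)
    qed
  qed
  moreover have "(\<Sum>i<m. V i * W j i) = 0" if "j \<in> {1..m}" for j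
  proof (cases "j \<le> n")
    case True
    then show ?thesis using V_tangent[of j] that by (simp add: W_def)
  next
    case False
    then have "j - n \<in> {1..p}" using that m by auto
    then show ?thesis using V_normal[of "j - n"] False by (simp add: W_def)
  qed
  ultimately show ?thesis
    using lin_indep_square_orthogonal[of "{1..m}" "{..<m}" W V l] l by simp
qed

section \<open>Branches of roots and primitives\<close>

text \<open>
  If \<open>f - g\<close> is not identically zero, it has no zeros on a non-empty open set, where then \<open>f + g\<close>
  vanishes; the identity theorem extends this to the connected domain.
\<close>

lemma holomorphic_equal_squares:
  assumes D: "open D" "connected D" and f: "f holomorphic_on D" and g: "g holomorphic_on D"
    and eq: "\<And>t. t \<in> D \<Longrightarrow> (f t)\<^sup>2 = (g t)\<^sup>2"
  obtains \<epsilon> :: complex where "\<epsilon> \<in> {1, -1}" "\<And>t. t \<in> D \<Longrightarrow> f t = \<epsilon> * g t"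
proof (cases "\<forall>t\<in>D. f t = g t")
  case True
  then show ?thesis using that[of 1] by simp
next
  case False
  then obtain t0 where t0: "t0 \<in> D" "f t0 \<noteq> g t0" by blast
  define U where "U = {t \<in> D. f t - g t \<in> - {0}}"
  have hol: "(\<lambda>t. f t - g t) holomorphic_on D" using f g by (intro holomorphic_intros)
  have "U = D \<inter> (\<lambda>t. f t - g t) -` (- {0})" by (auto simp: U_def)
  then have "open U"
    using continuous_open_preimage[OF holomorphic_on_imp_continuous_on[OF hol] D(1), of "- {0}"]
    by (simp only:) auto
  moreover have "f t = - g t" if "t \<in> U" for t
    using eq[of t] that by (auto simp: U_def power2_eq_iff)
  moreover have "U \<noteq> {}" "U \<subseteq> D" using t0 by (auto simp: U_def)
  moreover have "(\<lambda>t. - g t) holomorphic_on D" using g by (rule holomorphic_on_minus)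
  ultimately have "f t = - g t" if "t \<in> D" for t
    using analytic_continuation_open[OF _ D(1) _ D(2) _ f, of U "\<lambda>t. - g t" t] that by metis
  then show ?thesis using that[of "-1"] by simp
qed

lemma integral_from_base:
  assumes "integral_from b D \<phi> G"
  shows "G b = 0"
proof -
  have "(\<phi> has_contour_integral G (pathfinish (linepath b b))) (linepath b b)"
    using assms unfolding integral_from_def by (metis valid_path_linepath path_image_linepath
        closed_segment_idem empty_subsetI insert_subset pathstart_linepath)
  moreover have "(\<phi> has_contour_integral 0) (linepath b b)"
    by (rule has_contour_integral_trivial)
  ultimately show ?thesis using has_contour_integral_unique by fastforce
qed

text \<open>
  Near \<open>t\<close> the integral is continued along straight segments, so it differs by a constant
  from a local primitive of the integrand on a disc.
\<close>

lemma integral_from_has_field_derivative: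
  assumes "integral_from b D \<phi> G" and D: "open D" "connected D" and t: "t \<in> D"
  shows "(G has_field_derivative \<phi> t) (at t)"
proof -
  have b: "b \<in> D" and \<phi>: "\<phi> holomorphic_on D"
    and int: "\<And>p. valid_path p \<Longrightarrow> path_image p \<subseteq> D \<Longrightarrow> pathstart p = b \<Longrightarrow>
                (\<phi> has_contour_integral G (pathfinish p)) p"
    using assms(1) by (auto simp: integral_from_def)
  obtain p where p: "polynomial_function p" "path_image p \<subseteq> D" "pathstart p = b" "pathfinish p = t"
    using connected_open_polynomial_connected[OF D b t] by blast
  then have vp: "valid_path p" by (simp add: valid_path_polynomial_function)
  obtain e where e: "e > 0" "ball t e \<subseteq> D" using D(1) t openE by blast
  obtain \<Phi> where \<Phi>: "\<And>x. x \<in> ball t e \<Longrightarrow> (\<Phi> has_field_derivative \<phi> x) (at x)"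
    using holomorphic_convex_primitive'[of "ball t e" \<phi>] holomorphic_on_subset[OF \<phi> e(2)]
    by (metis at_within_open convex_ball open_ball)
  have "G w = G t + (\<Phi> w - \<Phi> t)" if w: "w \<in> ball t e" for w
  proof -
    have seg: "closed_segment t w \<subseteq> ball t e"
      using w e(1) by (intro closed_segment_subset) auto
    have \<Phi>w: "(\<phi> has_contour_integral (\<Phi> w - \<Phi> t)) (linepath t w)"
      using contour_integral_primitive[of "ball t e" \<Phi> \<phi> "linepath t w"] \<Phi> seg
      by (simp add: has_field_derivative_at_within)
    have "(\<phi> has_contour_integral (G t + (\<Phi> w - \<Phi> t))) (p +++ linepath t w)"
      using int[OF vp p(2,3)] \<Phi>w vp p(4) by (intro has_contour_integral_join) auto
    moreover have "(\<phi> has_contour_integral G w) (p +++ linepath t w)"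
      using int[of "p +++ linepath t w"] vp p seg e(2)
      by (auto simp: path_image_join intro!: valid_path_join)
    ultimately show ?thesis using has_contour_integral_unique by blast
  qed
  moreover have "((\<lambda>w. G t + (\<Phi> w - \<Phi> t)) has_field_derivative \<phi> t) (at t)"
    using \<Phi>[of t] e(1) by (auto intro!: derivative_eq_intros)
  ultimately show ?thesis
    using DERIV_cong_ev[of t t G "\<lambda>w. G t + (\<Phi> w - \<Phi> t)" "\<phi> t" "\<phi> t"] e(1)
    by (metis (mono_tags, lifting) centre_in_ball eventually_nhds open_ball)
qed

lemma sqrt_branch_deriv:
  assumes "sqrt_branch D \<phi> r" "open D" "t \<in> D" "(\<phi> has_field_derivative \<phi>') (at t)"
  shows "2 * r t * deriv r t = \<phi>'"
proof -
  have "(r has_field_derivative deriv r t) (at t)"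
    using assms by (auto simp: sqrt_branch_def intro: holomorphic_derivI)
  then have "((\<lambda>x. (r x)\<^sup>2) has_field_derivative 2 * r t * deriv r t) (at t)"
    by (auto intro!: derivative_eq_intros)
  moreover have "\<forall>\<^sub>F x in nhds t. (r x)\<^sup>2 = \<phi> x"
    using assms by (auto simp: sqrt_branch_def eventually_nhds)
  ultimately have "(\<phi> has_field_derivative 2 * r t * deriv r t) (at t)"
    using DERIV_cong_ev[OF refl, of "\<lambda>x. (r x)\<^sup>2" \<phi> t] by simp
  then show ?thesis using assms(4) DERIV_unique by blast
qed

lemma equal_derivatives_imp_eq:
  fixes G H :: "complex \<Rightarrow> complex"
  assumes D: "open D" "connected D"
    and G: "\<And>t. t \<in> D \<Longrightarrow> (G has_field_derivative \<phi> t) (at t)"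
    and H: "\<And>t. t \<in> D \<Longrightarrow> (H has_field_derivative \<phi> t) (at t)"
    and b: "b \<in> D" "G b = H b" and t: "t \<in> D"
  shows "G t = H t"
proof -
  have "((\<lambda>t. G t - H t) has_field_derivative 0) (at t)" if "t \<in> D" for t
    using DERIV_diff[OF G[OF that] H[OF that]] by simp
  then have "(\<lambda>t. G t - H t) constant_on D"
    using D by (intro has_field_derivative_0_imp_constant_on)
  then have "G t - H t = G b - H b" using b(1) t by (auto simp: constant_on_def)
  then show ?thesis using b(2) by simp
qed

text \<open>
  Two functions with the same logarithmic derivative have a constant quotient. Stated without
  quotients of \<open>p\<close>, so that \<open>p\<close> may vanish; \<open>c = 0\<close> gives a uniqueness statement.
\<close>

lemma proportional_log_derivatives:
  fixes p w :: "complex \<Rightarrow> complex"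
  assumes D: "open D" "connected D"
    and p: "\<And>t. t \<in> D \<Longrightarrow> (p has_field_derivative \<rho> t * p t) (at t)"
    and w: "\<And>t. t \<in> D \<Longrightarrow> (w has_field_derivative \<rho> t * w t) (at t)"
    and nz: "\<And>t. t \<in> D \<Longrightarrow> w t \<noteq> 0"
    and b: "b \<in> D" "p b = c * w b" and t: "t \<in> D"
  shows "p t = c * w t"
proof -
  have "((\<lambda>t. p t / w t) has_field_derivative 0) (at t)" if "t \<in> D" for t
    using DERIV_divide[OF p[OF that] w[OF that] nz[OF that]] by (simp add: mult_ac)
  then have "(\<lambda>t. p t / w t) constant_on D"
    using D by (intro has_field_derivative_0_imp_constant_on)
  then have "p t / w t = p b / w b" using b(1) t unfolding constant_on_def by metis
  then show ?thesis using b nz[OF t] nz[OF b(1)] by (simp add: field_simps)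
qed

section \<open>Maps whose components are separable products\<close>

definition separable :: "nat \<Rightarrow> (nat \<Rightarrow> complex \<Rightarrow> complex) \<Rightarrow> cvec \<Rightarrow> complex" where
  "separable n \<psi> w = (\<Prod>i=1..n. \<psi> i (w i))"

lemma analytic_at_imp_field_differentiable:
  "f analytic_on {x} \<Longrightarrow> f field_differentiable (at x)"
  by (simp add: analytic_on_imp_differentiable_at)

lemma eventually_field_differentiable:
  assumes "f analytic_on {x}"
  shows "\<forall>\<^sub>F t in nhds x. f field_differentiable (at t)"
proof -
  obtain S where S: "open S" "x \<in> S" "f holomorphic_on S"
    using assms by (auto simp: analytic_at)
  then show ?thesis
    by (auto simp: eventually_nhds intro!: exI[of _ S] holomorphic_on_imp_differentiable_at)
qed

lemma pd_separable:
  assumes "j \<in> {1..n}" "\<psi> j field_differentiable (at (u j))"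
  shows "pd j (separable n \<psi>) u = separable n (\<psi>(j := deriv (\<psi> j))) u"
proof -
  define K where "K = (\<Prod>i\<in>{1..n} - {j}. \<psi> i (u i))"
  have split: "separable n \<eta> (u(j := t)) = \<eta> j t * K" if "\<And>i. i \<noteq> j \<Longrightarrow> \<eta> i = \<psi> i" for \<eta> t
    unfolding separable_def K_def using assms(1) that
    by (subst prod.remove[of _ j]) (auto intro!: prod.cong)
  have "pd j (separable n \<psi>) u = deriv (\<lambda>t. \<psi> j t * K) (u j)"
    unfolding pd_def using split[of \<psi>] by simp
  also have "\<dots> = deriv (\<psi> j) (u j) * K"
    using assms(2) by (simp add: deriv_cmult_right)
  also have "\<dots> = separable n (\<psi>(j := deriv (\<psi> j))) u"
    using split[of "\<psi>(j := deriv (\<psi> j))" "u j"] by simp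
  finally show ?thesis .
qed

text \<open>
  The second differentiation sees the first derivative on a whole neighbourhood in the
  \<open>i\<close>-th direction, which is why analyticity at the point is assumed of the factors.
\<close>

lemma pd_pd_separable:
  assumes i: "i \<in> {1..n}" and j: "j \<in> {1..n}"
    and an: "\<And>k. k \<in> {1..n} \<Longrightarrow> \<psi> k analytic_on {u k}"
  shows "pd i (pd j (separable n \<psi>)) u =
    (let \<psi>' = \<psi>(j := deriv (\<psi> j)) in separable n (\<psi>'(i := deriv (\<psi>' i))) u)"
proof -
  define \<psi>' where "\<psi>' = \<psi>(j := deriv (\<psi> j))"
  have "\<forall>\<^sub>F t in nhds (u i). pd j (separable n \<psi>) (u(i := t)) = separable n \<psi>' (u(i := t))"
  proof (cases "i = j")
    case True
    have "\<forall>\<^sub>F t in nhds (u i). \<psi> j field_differentiable (at t)"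
      using eventually_field_differentiable[OF an[OF j]] True by simp
    then show ?thesis
      by (rule eventually_mono) (use j True in \<open>auto simp: \<psi>'_def intro!: pd_separable\<close>)
  next
    case False
    then show ?thesis
      using analytic_at_imp_field_differentiable[OF an[OF j]] j
      by (intro always_eventually allI) (auto simp: \<psi>'_def intro!: pd_separable)
  qed
  then have "pd i (pd j (separable n \<psi>)) u = pd i (separable n \<psi>') u"
    unfolding pd_def[of i] by (intro deriv_cong_ev) auto
  also have "\<dots> = separable n (\<psi>'(i := deriv (\<psi>' i))) u"
  proof (rule pd_separable[OF i])
    have "\<psi>' i analytic_on {u i}"
      using an[OF i] by (auto simp: \<psi>'_def intro: analytic_deriv)
    then show "\<psi>' i field_differentiable (at (u i))"
      by (rule analytic_at_imp_field_differentiable)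
  qed
  finally show ?thesis by (simp add: \<psi>'_def)
qed

text \<open>
  The partial derivative \<open>\<partial>\<^sub>j C\<^sub>k\<close>. Being written as a product and not as \<open>- tan u\<^sup>j C\<^sub>k\<close>, it remains
  correct where a cosine vanishes.
\<close>

definition dcos_prod :: "nat \<Rightarrow> nat \<Rightarrow> nat \<Rightarrow> cvec \<Rightarrow> complex" where
  "dcos_prod n k j u =
     (if j \<in> {k+1..n} then (\<Prod>i=k+1..n. if i = j then - sin (u i) else cos (u i)) else 0)"

text \<open>
  The factors of \<open>C\<^sub>k(u) \<eta>(u\<^sup>k)\<close> as a separable product of \<open>u\<^sup>1, \<dots>, u\<^sup>n\<close>.
\<close>

definition slot :: "nat \<Rightarrow> (complex \<Rightarrow> complex) \<Rightarrow> nat \<Rightarrow> complex \<Rightarrow> complex" where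
  "slot k \<eta> i = (if i < k then (\<lambda>_. 1) else if i = k then \<eta> else cos)"

lemma separable_split:
  assumes "k \<in> {1..n}"
  shows "separable n \<psi> u = (\<Prod>i=1..<k. \<psi> i (u i)) * \<psi> k (u k) * (\<Prod>i=k+1..n. \<psi> i (u i))"
proof -
  have "{1..n} = {1..<k} \<union> ({k} \<union> {k+1..n})" using assms by auto
  then show ?thesis unfolding separable_def
    by (simp only:) (subst prod.union_disjoint; auto simp: mult.assoc)+
qed

lemma separable_slot:
  assumes "k \<in> {1..n}"
  shows "separable n (slot k \<eta>) u = cos_prod n k u * \<eta> (u k)"
  using assms by (simp add: separable_split slot_def cos_prod_def)

lemma separable_slot_upd:
  assumes k: "k \<in> {1..n}" and j: "j \<in> {1..n}"
  shows "separable n ((slot k \<eta>)(j := deriv (slot k \<eta> j))) u =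
    dcos_prod n k j u * \<eta> (u k) + (if j = k then cos_prod n k u * deriv \<eta> (u k) else 0)"
proof -
  have cos': "deriv cos = (\<lambda>x::complex. - sin x)"
    by (auto intro!: DERIV_imp_deriv derivative_eq_intros)
  consider "j < k" | "j = k" | "j > k" by linarith
  then show ?thesis
  proof cases
    case 1
    then have "(\<Prod>i=1..<k. ((slot k \<eta>)(j := deriv (slot k \<eta> j))) i (u i)) = 0"
      using j by (intro prod_zero) (auto simp: slot_def intro!: bexI[of _ j])
    then have "separable n ((slot k \<eta>)(j := deriv (slot k \<eta> j))) u = 0"
      by (simp only: separable_split[OF k] mult_zero_left)
    then show ?thesis using 1 by (simp add: dcos_prod_def)
  next
    case 2
    then show ?thesis using k by (simp add: separable_split dcos_prod_def slot_def cos_prod_def)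
  next
    case 3
    let ?\<psi> = "(slot k \<eta>)(j := deriv (slot k \<eta> j))"
    have "(\<Prod>i=1..<k. ?\<psi> i (u i)) = 1" "?\<psi> k (u k) = \<eta> (u k)"
      using 3 by (auto simp: slot_def intro!: prod.neutral)
    moreover have "(\<Prod>i=k+1..n. ?\<psi> i (u i)) = dcos_prod n k j u"
      using 3 j by (auto simp: dcos_prod_def slot_def cos' intro!: prod.cong)
    ultimately have "separable n ?\<psi> u = dcos_prod n k j u * \<eta> (u k)"
      by (simp only: separable_split[OF k]) simp
    then show ?thesis using 3 by simp
  qed
qed

lemma dcos_prod_pred:
  assumes "k \<in> {1..n}" "j \<in> {1..n}"
  shows "dcos_prod n (k - 1) j u =
    cos (u k) * dcos_prod n k j u - (if j = k then sin (u k) * cos_prod n k u else 0)"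
proof -
  have "{k - 1 + 1..n} = insert k {k+1..n}" using assms by auto
  then show ?thesis unfolding dcos_prod_def cos_prod_def
    using assms by (auto intro!: prod.cong)
qed

lemma cos_prod_pred:
  assumes "k \<in> {1..n}"
  shows "cos_prod n (k - 1) u = cos (u k) * cos_prod n k u"
proof -
  have "{k - 1 + 1..n} = insert k {k+1..n}" using assms by auto
  then show ?thesis unfolding cos_prod_def by simp
qed

lemma cos_prod_top: "cos_prod n n u = 1"
  by (simp add: cos_prod_def)

definition dcos_along :: "nat \<Rightarrow> nat \<Rightarrow> cvec \<Rightarrow> cvec \<Rightarrow> complex" where
  "dcos_along n k u v = (\<Sum>j=1..n. dcos_prod n k j u * v j)"

lemma dcos_along_pred:
  assumes "k \<in> {1..n}"
  shows "dcos_along n (k - 1) u v =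
    cos (u k) * dcos_along n k u v - sin (u k) * cos_prod n k u * v k"
proof -
  have "dcos_along n (k - 1) u v = (\<Sum>j=1..n. cos (u k) * (dcos_prod n k j u * v j)
      - (if j = k then sin (u k) * cos_prod n k u * v j else 0))"
    unfolding dcos_along_def
    by (intro sum.cong refl, subst dcos_prod_pred[OF assms]) (auto simp: algebra_simps)
  also have "\<dots> = cos (u k) * dcos_along n k u v - sin (u k) * cos_prod n k u * v k"
    unfolding sum_subtractf dcos_along_def sum_distrib_left[symmetric] using assms by simp
  finally show ?thesis .
qed

lemma dcos_along_top: "dcos_along n n u v = 0"
  by (simp add: dcos_along_def dcos_prod_def)

text \<open>
  The common shape of the quadric and its deformations: each component of \<open>F\<close> lives on one
  level \<open>k = \<kappa> l\<close>, that is, it is a function of \<open>u\<^sup>k\<close> scaled by \<open>C\<^sub>k\<close>.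
\<close>

locale warped_map =
  fixes n m :: nat and \<kappa> :: "nat \<Rightarrow> nat" and \<phi> :: "nat \<Rightarrow> complex \<Rightarrow> complex"
    and F :: "cvec \<Rightarrow> cvec" and u :: cvec
  assumes level: "l < m \<Longrightarrow> \<kappa> l \<in> {1..n}"
    and component: "l < m \<Longrightarrow> F w l = cos_prod n (\<kappa> l) w * \<phi> l (w (\<kappa> l))"
    and analytic: "l < m \<Longrightarrow> \<phi> l analytic_on {u (\<kappa> l)}"
begin

lemma component_separable: "l < m \<Longrightarrow> (\<lambda>w. F w l) = separable n (slot (\<kappa> l) (\<phi> l))"
  using component separable_slot[OF level] by auto

lemma slot_analytic: "l < m \<Longrightarrow> slot (\<kappa> l) (\<phi> l) k analytic_on {u k}"
  using analytic[of l]
  by (auto simp: slot_def intro!: analytic_intros holomorphic_on_imp_analytic_at[of _ UNIV] holomorphic_intros)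

lemma tangent_eq:
  assumes "l < m" "j \<in> {1..n}"
  shows "tangent F u j l = dcos_prod n (\<kappa> l) j u * \<phi> l (u (\<kappa> l))
    + (if j = \<kappa> l then cos_prod n (\<kappa> l) u * deriv (\<phi> l) (u (\<kappa> l)) else 0)"
  unfolding tangent_def component_separable[OF assms(1)]
  using pd_separable[OF assms(2)] slot_analytic[OF assms(1)] separable_slot_upd[OF level[OF assms(1)] assms(2)]
  by (simp add: analytic_at_imp_field_differentiable)

text \<open>
  The differential is evaluated on a general direction, because for coordinate fields the
  telescoping would need case distinctions on the coordinate.
\<close>

definition along :: "cvec \<Rightarrow> nat \<Rightarrow> complex" where
  "along v l = (\<Sum>j=1..n. tangent F u j l * v j)"

lemma along_eq:
  assumes "l < m"
  shows "along v l = dcos_along n (\<kappa> l) u v * \<phi> l (u (\<kappa> l))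
    + cos_prod n (\<kappa> l) u * v (\<kappa> l) * deriv (\<phi> l) (u (\<kappa> l))"
proof -
  have "along v l = (\<Sum>j=1..n. dcos_prod n (\<kappa> l) j u * v j * \<phi> l (u (\<kappa> l))
      + (if j = \<kappa> l then cos_prod n (\<kappa> l) u * v j * deriv (\<phi> l) (u (\<kappa> l)) else 0))"
    unfolding along_def using tangent_eq[OF assms] by (intro sum.cong) (auto simp: algebra_simps)
  also have "\<dots> = dcos_along n (\<kappa> l) u v * \<phi> l (u (\<kappa> l))
    + cos_prod n (\<kappa> l) u * v (\<kappa> l) * deriv (\<phi> l) (u (\<kappa> l))"
    unfolding sum.distrib dcos_along_def sum_distrib_right using level[OF assms] by simp
  finally show ?thesis .
qed

text \<open>
  The identity behind conjugacy. A component on level \<open>k\<close> does not depend on \<open>u\<^sup>i\<close> if \<open>i < k\<close>, and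
  otherwise its factor in \<open>u\<^sup>j\<close> is \<open>cos u\<^sup>j\<close>. Multiplied by \<open>cos u\<^sup>j\<close>, the relation also makes
  sense, and carries information, where \<open>cos u\<^sup>j = 0\<close>.
\<close>

lemma mixed_second_derivative:
  assumes l: "l < m" and ij: "i \<in> {1..n}" "j \<in> {1..n}" "i < j"
  shows "cos (u j) * pd i (pd j (\<lambda>w. F w l)) u = - sin (u j) * tangent F u i l"
    and "cos (u j) * pd j (pd i (\<lambda>w. F w l)) u = - sin (u j) * tangent F u i l"
proof -
  define \<psi> where "\<psi> = slot (\<kappa> l) (\<phi> l)"
  define Q where "Q \<eta> \<omega> = \<eta> (u i) * \<omega> (u j) * (\<Prod>k\<in>{1..n} - {i, j}. \<psi> k (u k))"
    for \<eta> \<omega> :: "complex \<Rightarrow> complex"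
  have Q: "separable n (\<psi>(i := \<eta>, j := \<omega>)) u = Q \<eta> \<omega>" for \<eta> \<omega>
  proof -
    have "{1..n} = insert i (insert j ({1..n} - {i, j}))" using ij by auto
    then have "separable n (\<psi>(i := \<eta>, j := \<omega>)) u =
        (\<Prod>k\<in>insert i (insert j ({1..n} - {i, j})). (\<psi>(i := \<eta>, j := \<omega>)) k (u k))"
      unfolding separable_def by metis
    also have "\<dots> = \<eta> (u i) * (\<omega> (u j) * (\<Prod>k\<in>{1..n} - {i, j}. (\<psi>(i := \<eta>, j := \<omega>)) k (u k)))"
      using ij by simp
    also have "(\<Prod>k\<in>{1..n} - {i, j}. (\<psi>(i := \<eta>, j := \<omega>)) k (u k)) =
        (\<Prod>k\<in>{1..n} - {i, j}. \<psi> k (u k))"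
      by (intro prod.cong) auto
    finally show ?thesis by (simp only: Q_def mult.assoc)
  qed
  have an: "\<psi> k analytic_on {u k}" for k
    unfolding \<psi>_def by (rule slot_analytic[OF l])
  have upd: "\<psi>(i := \<eta>, j := \<psi> j) = \<psi>(i := \<eta>)" "\<psi>(j := \<omega>, i := \<eta>) = \<psi>(i := \<eta>, j := \<omega>)" for \<eta> \<omega>
    using ij(3) by (auto simp: fun_eq_iff)
  have T: "tangent F u i l = Q (deriv (\<psi> i)) (\<psi> j)"
    unfolding tangent_def component_separable[OF l] \<psi>_def[symmetric]
      pd_separable[of i n \<psi> u, OF ij(1) analytic_at_imp_field_differentiable[OF an]]
    by (simp only: Q[symmetric] upd)
  have S1: "pd i (pd j (\<lambda>w. F w l)) u = Q (deriv (\<psi> i)) (deriv (\<psi> j))"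
    unfolding component_separable[OF l] \<psi>_def[symmetric] pd_pd_separable[of i n j \<psi> u, OF ij(1,2) an] Let_def
      Q[symmetric] upd(2)[symmetric] using ij(3) by simp
  have S2: "pd j (pd i (\<lambda>w. F w l)) u = Q (deriv (\<psi> i)) (deriv (\<psi> j))"
    unfolding component_separable[OF l] \<psi>_def[symmetric] pd_pd_separable[of j n i \<psi> u, OF ij(2,1) an] Let_def
      Q[symmetric] using ij(3) by simp
  have "cos (u j) * Q (deriv (\<psi> i)) (deriv (\<psi> j)) = - sin (u j) * Q (deriv (\<psi> i)) (\<psi> j)"
  proof (cases "i < \<kappa> l")
    case True
    then show ?thesis by (simp add: Q_def \<psi>_def slot_def)
  next
    case False
    then have "\<psi> j = cos" using ij(3) by (simp add: \<psi>_def slot_def)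
    moreover have "deriv cos (u j) = - sin (u j)"
      by (auto intro!: DERIV_imp_deriv derivative_eq_intros)
    ultimately show ?thesis by (simp add: Q_def)
  qed
  with T S1 S2 show "cos (u j) * pd i (pd j (\<lambda>w. F w l)) u = - sin (u j) * tangent F u i l"
    and "cos (u j) * pd j (pd i (\<lambda>w. F w l)) u = - sin (u j) * tangent F u i l"
    by simp_all
qed

lemma pure_second_derivative:
  assumes l: "l < m" and j: "j \<in> {1..n}"
  shows "pd j (pd j (\<lambda>w. F w l)) u = (if j < \<kappa> l then 0
    else if j = \<kappa> l then cos_prod n (\<kappa> l) u * deriv (deriv (\<phi> l)) (u (\<kappa> l))
    else - (cos_prod n (\<kappa> l) u * \<phi> l (u (\<kappa> l))))"
proof -
  define \<psi> where "\<psi> = slot (\<kappa> l) (\<phi> l)"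
  define k where "k = \<kappa> l"
  have k: "k \<in> {1..n}" unfolding k_def by (rule level[OF l])
  have "pd j (pd j (\<lambda>w. F w l)) u = separable n (\<psi>(j := deriv (deriv (\<psi> j)))) u"
    unfolding component_separable[OF l] \<psi>_def
    using pd_pd_separable[OF j j, of "slot (\<kappa> l) (\<phi> l)" u] slot_analytic[OF l] by (simp add: Let_def)
  also have "\<dots> = (\<Prod>i=1..<k. (\<psi>(j := deriv (deriv (\<psi> j)))) i (u i)) *
      (\<psi>(j := deriv (deriv (\<psi> j)))) k (u k) * (\<Prod>i=k+1..n. (\<psi>(j := deriv (deriv (\<psi> j)))) i (u i))"
    by (rule separable_split[OF k])
  also have "\<dots> = (if j < k then 0
    else if j = k then cos_prod n k u * deriv (deriv (\<phi> l)) (u k)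
    else - (cos_prod n k u * \<phi> l (u k)))"
  proof -
    have cos': "deriv cos = (\<lambda>x::complex. - sin x)" and sin': "deriv (\<lambda>x::complex. - sin x) = (\<lambda>x. - cos x)"
      by (auto intro!: DERIV_imp_deriv derivative_eq_intros)
    consider "j < k" | "j = k" | "j > k" by linarith
    then show ?thesis
    proof cases
      case 1
      then have "(\<Prod>i=1..<k. (\<psi>(j := deriv (deriv (\<psi> j)))) i (u i)) = 0"
        using j by (intro prod_zero) (auto simp: \<psi>_def slot_def k_def[symmetric] intro!: bexI[of _ j])
      then show ?thesis using 1 by simp
    next
      case 2
      then show ?thesis by (simp add: \<psi>_def slot_def cos_prod_def k_def[symmetric])
    next
      case 3
      have "(\<Prod>i=k+1..n. (\<psi>(j := deriv (deriv (\<psi> j)))) i (u i)) =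
          (\<Prod>i=k+1..n. (if i = j then - 1 else 1) * cos (u i))"
        using 3 by (intro prod.cong) (auto simp: \<psi>_def slot_def k_def[symmetric] cos' sin')
      also have "\<dots> = - cos_prod n k u"
        using 3 j by (simp add: prod.distrib cos_prod_def)
      finally show ?thesis using 3 by (simp add: \<psi>_def slot_def k_def[symmetric])
    qed
  qed
  finally show ?thesis by (simp add: k_def)
qed

end

section \<open>Levels with prescribed radius and speed\<close>

lemma sum_product_derivative:
  fixes \<phi> \<eta> :: "'i \<Rightarrow> complex \<Rightarrow> complex"
  assumes diff: "\<And>l. l \<in> S \<Longrightarrow> \<phi> l field_differentiable (at t)"
      "\<And>l. l \<in> S \<Longrightarrow> \<eta> l field_differentiable (at t)"
    and eq: "\<forall>\<^sub>F s in nhds t. (\<Sum>l\<in>S. \<phi> l s * \<eta> l s) = G s"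
    and G: "(G has_field_derivative G') (at t)"
  shows "(\<Sum>l\<in>S. deriv (\<phi> l) t * \<eta> l t + \<phi> l t * deriv (\<eta> l) t) = G'"
proof -
  have "((\<lambda>s. \<Sum>l\<in>S. \<phi> l s * \<eta> l s) has_field_derivative
      (\<Sum>l\<in>S. deriv (\<phi> l) t * \<eta> l t + \<phi> l t * deriv (\<eta> l) t)) (at t)"
  proof (rule DERIV_sum)
    fix l assume "l \<in> S"
    then have "(\<phi> l has_field_derivative deriv (\<phi> l) t) (at t)"
      "(\<eta> l has_field_derivative deriv (\<eta> l) t) (at t)"
      using diff field_differentiable_derivI by blast+
    then show "((\<lambda>s. \<phi> l s * \<eta> l s) has_field_derivative
        deriv (\<phi> l) t * \<eta> l t + \<phi> l t * deriv (\<eta> l) t) (at t)"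
      by (auto intro!: derivative_eq_intros)
  qed
  then have "(G has_field_derivative
      (\<Sum>l\<in>S. deriv (\<phi> l) t * \<eta> l t + \<phi> l t * deriv (\<eta> l) t)) (at t)"
    using DERIV_cong_ev[OF refl eq refl] by simp
  then show ?thesis using G DERIV_unique by blast
qed

text \<open>
  As \<open>\<partial>\<^sub>j\<^sup>2 C\<^sub>k = - C\<^sub>k\<close> for \<open>j > k\<close>, the operator \<open>\<Sum> c\<^sub>j \<partial>\<^sub>j\<^sup>2\<close> multiplies \<open>C\<^sub>k\<close> by minus this number.
\<close>

definition tail_sum :: "nat \<Rightarrow> cvec \<Rightarrow> nat \<Rightarrow> complex" where
  "tail_sum n c k = (\<Sum>j=k+1..n. c j)"

lemma tail_sum_pred: "k \<in> {1..n} \<Longrightarrow> tail_sum n c (k - 1) = c k + tail_sum n c k"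
  unfolding tail_sum_def by (subst sum.atLeast_Suc_atMost) auto

lemma tail_sum_top: "tail_sum n c n = 0"
  by (simp add: tail_sum_def)

text \<open>
  The derivative along \<open>v\<close> of \<open>C\<^sub>k sin u\<^sup>k\<close>, the \<open>k\<close>-th coordinate of the point of the unit
  sphere.
\<close>

definition sphere_along :: "nat \<Rightarrow> nat \<Rightarrow> cvec \<Rightarrow> cvec \<Rightarrow> complex" where
  "sphere_along n k u v = sin (u k) * dcos_along n k u v + cos_prod n k u * cos (u k) * v k"

text \<open>
  With the operator \<open>L = \<Sum> (c\<^sub>j \<partial>\<^sub>j\<^sup>2 - t\<^sub>j \<partial>\<^sub>j)\<close>, this is \<open>L C\<^sub>k\<close>.
\<close>

definition level_defect :: "nat \<Rightarrow> cvec \<Rightarrow> cvec \<Rightarrow> cvec \<Rightarrow> nat \<Rightarrow> complex" where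
  "level_defect n u c t k = - (tail_sum n c k * cos_prod n k u) - dcos_along n k u t"

text \<open>
  For the same operator, this is \<open>L (C\<^sub>k sin u\<^sup>k)\<close>.
\<close>

definition sphere_defect :: "nat \<Rightarrow> cvec \<Rightarrow> cvec \<Rightarrow> cvec \<Rightarrow> nat \<Rightarrow> complex" where
  "sphere_defect n u c t k =
     sin (u k) * (level_defect n u c t k - cos_prod n k u * c k) - cos (u k) * cos_prod n k u * t k"

lemma level_defect_pred:
  assumes "k \<in> {1..n}"
  shows "level_defect n u c t (k - 1) =
    cos (u k) * (level_defect n u c t k - cos_prod n k u * c k) + sin (u k) * cos_prod n k u * t k"
  unfolding level_defect_def tail_sum_pred[OF assms] dcos_along_pred[OF assms] cos_prod_pred[OF assms]
  by (simp add: algebra_simps)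

lemma level_defect_top: "level_defect n u c t n = 0"
  by (simp add: level_defect_def tail_sum_top dcos_along_top)

text \<open>
  Components of one level together have a prescribed squared radius and squared speed. On the
  last level \<open>C\<^sub>n = 1\<close> is constant and only the speed matters; this is why the integral \<open>h\<close>
  can replace a sine. The relations hold near \<open>u\<close>, since they will be differentiated.
\<close>

locale profiled_map = warped_map +
  fixes a A :: "nat \<Rightarrow> complex"
  assumes radius: "k \<in> {1..<n} \<Longrightarrow> \<forall>\<^sub>F t in nhds (u k).
      (\<Sum>l | l < m \<and> \<kappa> l = k. (\<phi> l t)\<^sup>2) = a k * (sin t)\<^sup>2 + A (k - 1) * (cos t)\<^sup>2 - A k"
    and speed: "k \<in> {1..n} \<Longrightarrow> \<forall>\<^sub>F t in nhds (u k).
      (\<Sum>l | l < m \<and> \<kappa> l = k. (deriv (\<phi> l) t)\<^sup>2) = a k * (cos t)\<^sup>2 + A (k - 1) * (sin t)\<^sup>2"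
begin

lemma sum_radius: "k \<in> {1..<n} \<Longrightarrow> (\<Sum>l | l < m \<and> \<kappa> l = k. \<phi> l (u k) * \<phi> l (u k)) =
    a k * (sin (u k))\<^sup>2 + A (k - 1) * (cos (u k))\<^sup>2 - A k"
  using eventually_nhds_x_imp_x[OF radius] by (simp add: power2_eq_square)

lemma sum_speed: "k \<in> {1..n} \<Longrightarrow> (\<Sum>l | l < m \<and> \<kappa> l = k. deriv (\<phi> l) (u k) * deriv (\<phi> l) (u k)) =
    a k * (cos (u k))\<^sup>2 + A (k - 1) * (sin (u k))\<^sup>2"
  using eventually_nhds_x_imp_x[OF speed] by (simp add: power2_eq_square)

lemma eventually_sum_radial_velocity:
  assumes k: "k \<in> {1..<n}"
  shows "\<forall>\<^sub>F t in nhds (u k). (\<Sum>l | l < m \<and> \<kappa> l = k. \<phi> l t * deriv (\<phi> l) t) =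
    (a k - A (k - 1)) * sin t * cos t"
proof -
  have "\<forall>\<^sub>F t in nhds (u k). \<forall>l\<in>{l. l < m \<and> \<kappa> l = k}. \<phi> l field_differentiable (at t)"
    by (intro eventually_ball_finite ballI)
       (auto intro!: eventually_field_differentiable analytic)
  moreover have "\<forall>\<^sub>F t in nhds (u k). \<forall>\<^sub>F s in nhds t.
      (\<Sum>l | l < m \<and> \<kappa> l = k. (\<phi> l s)\<^sup>2) = a k * (sin s)\<^sup>2 + A (k - 1) * (cos s)\<^sup>2 - A k"
    using radius[OF k] by (simp add: eventually_eventually)
  ultimately show ?thesis
  proof eventually_elim
    case (elim t)
    have "((\<lambda>s. a k * (sin s)\<^sup>2 + A (k - 1) * (cos s)\<^sup>2 - A k) has_field_derivative
        2 * ((a k - A (k - 1)) * sin t * cos t)) (at t)"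
      by (auto intro!: derivative_eq_intros simp: algebra_simps)
    then have "(\<Sum>l | l < m \<and> \<kappa> l = k. deriv (\<phi> l) t * \<phi> l t + \<phi> l t * deriv (\<phi> l) t) =
        2 * ((a k - A (k - 1)) * sin t * cos t)"
      using elim by (intro sum_product_derivative[where G = "\<lambda>s. a k * (sin s)\<^sup>2 + A (k - 1) * (cos s)\<^sup>2 - A k"])
        (auto simp: power2_eq_square)
    then show ?case by (simp add: mult.commute sum.distrib sum_distrib_left[symmetric] flip: mult_2)
  qed
qed

lemma sum_radial_velocity: "k \<in> {1..<n} \<Longrightarrow> (\<Sum>l | l < m \<and> \<kappa> l = k. \<phi> l (u k) * deriv (\<phi> l) (u k)) =
    (a k - A (k - 1)) * sin (u k) * cos (u k)"
  using eventually_nhds_x_imp_x[OF eventually_sum_radial_velocity] .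

text \<open>
  Differentiating \<open>\<Sum> \<phi> \<phi>'\<close> produces the speed together with the sum wanted here. So every
  inner product of \<open>\<phi>\<close>, \<open>\<phi>'\<close>, \<open>\<phi>''\<close> with at most one factor \<open>\<phi>''\<close> is determined by radius and
  speed; a product of two is not, which leaves room for different extrinsic geometries.
\<close>

lemma sum_radial_acceleration:
  assumes k: "k \<in> {1..<n}"
  shows "(\<Sum>l | l < m \<and> \<kappa> l = k. \<phi> l (u k) * deriv (deriv (\<phi> l)) (u k)) =
    - (a k * (sin (u k))\<^sup>2 + A (k - 1) * (cos (u k))\<^sup>2)"
proof -
  have "(\<Sum>l | l < m \<and> \<kappa> l = k. deriv (\<phi> l) (u k) * deriv (\<phi> l) (u k) + \<phi> l (u k) * deriv (deriv (\<phi> l)) (u k)) =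
      (a k - A (k - 1)) * ((cos (u k))\<^sup>2 - (sin (u k))\<^sup>2)"
    using eventually_sum_radial_velocity[OF k]
    by (rule sum_product_derivative[rotated 2])
       (auto intro!: derivative_eq_intros analytic_at_imp_field_differentiable analytic_deriv analytic
         simp: power2_eq_square algebra_simps)
  then have "(\<Sum>l | l < m \<and> \<kappa> l = k. \<phi> l (u k) * deriv (deriv (\<phi> l)) (u k)) =
      (a k - A (k - 1)) * ((cos (u k))\<^sup>2 - (sin (u k))\<^sup>2)
        - (a k * (cos (u k))\<^sup>2 + A (k - 1) * (sin (u k))\<^sup>2)"
    using sum_speed[of k] k by (simp add: sum.distrib eq_diff_eq add.commute)
  also have "\<dots> = - (a k * (sin (u k))\<^sup>2 + A (k - 1) * (cos (u k))\<^sup>2)"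
    by (simp add: algebra_simps)
  finally show ?thesis .
qed

lemma sum_tangential_acceleration:
  assumes k: "k \<in> {1..n}"
  shows "(\<Sum>l | l < m \<and> \<kappa> l = k. deriv (\<phi> l) (u k) * deriv (deriv (\<phi> l)) (u k)) =
    - ((a k - A (k - 1)) * sin (u k) * cos (u k))"
proof -
  have "\<forall>\<^sub>F t in nhds (u k). (\<Sum>l | l < m \<and> \<kappa> l = k. deriv (\<phi> l) t * deriv (\<phi> l) t) =
      a k * (cos t)\<^sup>2 + A (k - 1) * (sin t)\<^sup>2"
    using speed[OF k] by (simp add: power2_eq_square)
  then have "(\<Sum>l | l < m \<and> \<kappa> l = k. deriv (deriv (\<phi> l)) (u k) * deriv (\<phi> l) (u k)
        + deriv (\<phi> l) (u k) * deriv (deriv (\<phi> l)) (u k)) =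
      2 * (- ((a k - A (k - 1)) * sin (u k) * cos (u k)))"
    by (rule sum_product_derivative[rotated 2])
       (auto intro!: derivative_eq_intros analytic_at_imp_field_differentiable analytic_deriv analytic
         simp: algebra_simps)
  then show ?thesis by (simp add: mult.commute sum.distrib sum_distrib_left[symmetric] flip: mult_2)
qed

lemma sum_by_level: "(\<Sum>l<m. g l) = (\<Sum>k=1..n. \<Sum>l | l < m \<and> \<kappa> l = k. g l)"
  using sum.group[of "{..<m}" "{1..n}" \<kappa> g] level by (simp add: image_subset_iff)

text \<open>
  The heart of the isometry: level \<open>k\<close> contributes the multiple by \<open>a\<^sub>k\<close> of the squared
  differential of a sphere coordinate, in polarized form, plus
  \<open>T (k - 1) - T k\<close> where \<open>T k = A\<^sub>k dC\<^sub>k(v) dC\<^sub>k(w)\<close>. The right-hand side involves neither the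
  components of the map nor any \<open>A\<^sub>k\<close> with \<open>k \<ge> 1\<close>.
\<close>

lemma metric_eq:
  "(\<Sum>l<m. along v l * along w l) =
    (\<Sum>k=1..n. a k * sphere_along n k u v * sphere_along n k u w)
      + A 0 * dcos_along n 0 u v * dcos_along n 0 u w"
proof -
  define T where "T k = A k * dcos_along n k u v * dcos_along n k u w" for k
  have level_k: "(\<Sum>l | l < m \<and> \<kappa> l = k. along v l * along w l) =
      a k * sphere_along n k u v * sphere_along n k u w + (T (k - 1) - T k)" if k: "k \<in> {1..n}" for k
  proof -
    define C s c Dv Dw where "C = cos_prod n k u" and "s = sin (u k)" and "c = cos (u k)"
      and "Dv = dcos_along n k u v" and "Dw = dcos_along n k u w"
    have sc: "s\<^sup>2 + c\<^sup>2 = 1" by (simp add: s_def c_def)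
    have "(\<Sum>l | l < m \<and> \<kappa> l = k. along v l * along w l) =
      (\<Sum>l | l < m \<and> \<kappa> l = k. Dv * Dw * (\<phi> l (u k) * \<phi> l (u k))
        + C * (Dv * w k + Dw * v k) * (\<phi> l (u k) * deriv (\<phi> l) (u k))
        + C\<^sup>2 * v k * w k * (deriv (\<phi> l) (u k) * deriv (\<phi> l) (u k)))"
      by (intro sum.cong refl) (auto simp: along_eq C_def Dv_def Dw_def power2_eq_square algebra_simps)
    also have "\<dots> = Dv * Dw * (\<Sum>l | l < m \<and> \<kappa> l = k. \<phi> l (u k) * \<phi> l (u k))
        + C * (Dv * w k + Dw * v k) * (\<Sum>l | l < m \<and> \<kappa> l = k. \<phi> l (u k) * deriv (\<phi> l) (u k))
        + C\<^sup>2 * v k * w k * (\<Sum>l | l < m \<and> \<kappa> l = k. deriv (\<phi> l) (u k) * deriv (\<phi> l) (u k))"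
      by (simp add: sum.distrib sum_distrib_left)
    also have "\<dots> = Dv * Dw * (a k * s\<^sup>2 + A (k - 1) * c\<^sup>2 - A k)
        + C * (Dv * w k + Dw * v k) * ((a k - A (k - 1)) * s * c)
        + C\<^sup>2 * v k * w k * (a k * c\<^sup>2 + A (k - 1) * s\<^sup>2)"
    proof (cases "k = n")
      case True
      \<comment> \<open>there is no radius relation on the last level, but \<open>C\<^sub>n = 1\<close> has derivative \<open>0\<close>\<close>
      then have "Dv = 0" "Dw = 0" by (simp_all add: Dv_def Dw_def dcos_along_top)
      then show ?thesis using sum_speed[OF k] by (simp add: s_def c_def)
    next
      case False
      then have "k \<in> {1..<n}" using k by auto
      then show ?thesis using sum_radius[of k] sum_radial_velocity[of k] sum_speed[OF k]
        by (simp add: s_def c_def)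
    qed
    also have "\<dots> = a k * (s * Dv + C * c * v k) * (s * Dw + C * c * w k)
        + A (k - 1) * (c * Dv - s * C * v k) * (c * Dw - s * C * w k) - A k * Dv * Dw"
      by (simp add: power2_eq_square algebra_simps)
    also have "\<dots> = a k * sphere_along n k u v * sphere_along n k u w + (T (k - 1) - T k)"
      unfolding T_def dcos_along_pred[OF k] by (simp add: sphere_along_def C_def s_def c_def Dv_def Dw_def)
    finally show ?thesis .
  qed
  have "(\<Sum>k=1..n. T (k - 1) - T k) = T 0 - T n"
    using sum_telescope''[of 0 n "\<lambda>k. - T k"] by (simp add: sum_negf algebra_simps)
  then show ?thesis
    unfolding sum_by_level using level_k
    by (simp add: sum.distrib T_def dcos_along_top)
qed

definition second_diagonal :: "cvec \<Rightarrow> nat \<Rightarrow> complex" where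
  "second_diagonal c l = (\<Sum>j=1..n. c j * pd j (pd j (\<lambda>w. F w l)) u)"

lemma second_eq:
  assumes l: "l < m"
  shows "second_diagonal c l = cos_prod n (\<kappa> l) u *
    (c (\<kappa> l) * deriv (deriv (\<phi> l)) (u (\<kappa> l)) - tail_sum n c (\<kappa> l) * \<phi> l (u (\<kappa> l)))"
proof -
  let ?k = "\<kappa> l"
  have k: "?k \<in> {1..n}" by (rule level[OF l])
  have "second_diagonal c l = (\<Sum>j=1..n. (if j = ?k then c j * (cos_prod n ?k u * deriv (deriv (\<phi> l)) (u ?k)) else 0)
      - (if j \<in> {?k+1..n} then c j * (cos_prod n ?k u * \<phi> l (u ?k)) else 0))"
    unfolding second_diagonal_def
    by (intro sum.cong refl, subst pure_second_derivative[OF l]) auto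
  also have "\<dots> = c ?k * (cos_prod n ?k u * deriv (deriv (\<phi> l)) (u ?k))
      - (\<Sum>j\<in>{1..n} \<inter> {?k+1..n}. c j * (cos_prod n ?k u * \<phi> l (u ?k)))"
    using k by (simp only: sum_subtractf sum.inter_restrict[OF finite_atLeastAtMost] sum.delta
        finite_atLeastAtMost if_True)
  also have "{1..n} \<inter> {?k+1..n} = {?k+1..n}" using k by auto
  finally show ?thesis by (simp add: tail_sum_def sum_distrib_right[symmetric] algebra_simps)
qed

text \<open>
  Inner products of \<open>\<partial>\<^sub>j\<^sup>2 F\<close> with tangent vectors are Christoffel symbols, hence determined by the
  metric. It is shorter to see this directly: the same telescoping occurs, now with
  \<open>T k = A\<^sub>k C\<^sub>k (tail sum) dC\<^sub>k(w)\<close>.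
\<close>

lemma tangential_second_eq:
  "(\<Sum>l<m. second_diagonal c l * along w l) =
    - (\<Sum>k=1..n. a k * cos_prod n k u * tail_sum n c (k - 1) * sin (u k) * sphere_along n k u w)
      - A 0 * cos_prod n 0 u * tail_sum n c 0 * dcos_along n 0 u w"
proof -
  define T where "T k = A k * cos_prod n k u * tail_sum n c k * dcos_along n k u w" for k
  have level_k: "(\<Sum>l | l < m \<and> \<kappa> l = k. second_diagonal c l * along w l) =
      - (a k * cos_prod n k u * tail_sum n c (k - 1) * sin (u k) * sphere_along n k u w) + (T k - T (k - 1))"
    if k: "k \<in> {1..n}" for k
  proof -
    define C s cc D B where "C = cos_prod n k u" and "s = sin (u k)" and "cc = cos (u k)"
      and "D = dcos_along n k u w" and "B = tail_sum n c k"
    have "(\<Sum>l | l < m \<and> \<kappa> l = k. second_diagonal c l * along w l) =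
      (\<Sum>l | l < m \<and> \<kappa> l = k. C * c k * D * (\<phi> l (u k) * deriv (deriv (\<phi> l)) (u k))
        - C * B * D * (\<phi> l (u k) * \<phi> l (u k))
        + C\<^sup>2 * w k * c k * (deriv (\<phi> l) (u k) * deriv (deriv (\<phi> l)) (u k))
        - C\<^sup>2 * w k * B * (\<phi> l (u k) * deriv (\<phi> l) (u k)))"
      by (intro sum.cong refl)
         (auto simp: along_eq second_eq C_def D_def B_def power2_eq_square algebra_simps)
    also have "\<dots> = C * c k * D * (\<Sum>l | l < m \<and> \<kappa> l = k. \<phi> l (u k) * deriv (deriv (\<phi> l)) (u k))
        - C * B * D * (\<Sum>l | l < m \<and> \<kappa> l = k. \<phi> l (u k) * \<phi> l (u k))
        + C\<^sup>2 * w k * c k * (\<Sum>l | l < m \<and> \<kappa> l = k. deriv (\<phi> l) (u k) * deriv (deriv (\<phi> l)) (u k))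
        - C\<^sup>2 * w k * B * (\<Sum>l | l < m \<and> \<kappa> l = k. \<phi> l (u k) * deriv (\<phi> l) (u k))"
      by (simp add: sum.distrib sum_subtractf sum_distrib_left)
    also have "\<dots> = C * c k * D * (- (a k * s\<^sup>2 + A (k - 1) * cc\<^sup>2))
        - C * B * D * (a k * s\<^sup>2 + A (k - 1) * cc\<^sup>2 - A k)
        + C\<^sup>2 * w k * c k * (- ((a k - A (k - 1)) * s * cc))
        - C\<^sup>2 * w k * B * ((a k - A (k - 1)) * s * cc)"
    proof (cases "k = n")
      case True
      then have "D = 0" "B = 0" by (simp_all add: D_def B_def dcos_along_top tail_sum_top)
      then show ?thesis using sum_tangential_acceleration[OF k] by (simp add: s_def cc_def)
    next
      case False
      then have k': "k \<in> {1..<n}" using k by auto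
      show ?thesis unfolding sum_radius[OF k'] sum_radial_velocity[OF k']
          sum_radial_acceleration[OF k'] sum_tangential_acceleration[OF k]
        by (simp add: s_def cc_def)
    qed
    also have "\<dots> = - (a k * C * (c k + B) * s * (s * D + C * cc * w k))
        + A k * C * B * D - A (k - 1) * (cc * C) * (c k + B) * (cc * D - s * C * w k)"
      by (simp add: power2_eq_square algebra_simps)
    also have "\<dots> = - (a k * cos_prod n k u * tail_sum n c (k - 1) * sin (u k) * sphere_along n k u w)
        + (T k - T (k - 1))"
      unfolding T_def dcos_along_pred[OF k] cos_prod_pred[OF k] tail_sum_pred[OF k]
      by (simp add: sphere_along_def C_def s_def cc_def D_def B_def)
    finally show ?thesis .
  qed
  have telescope: "(\<Sum>k=1..n. T k - T (k - 1)) = T n - T 0"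
    using sum_telescope''[of 0 n T] by simp
  have "(\<Sum>l<m. second_diagonal c l * along w l) = (\<Sum>k=1..n.
      - (a k * cos_prod n k u * tail_sum n c (k - 1) * sin (u k) * sphere_along n k u w) + (T k - T (k - 1)))"
    unfolding sum_by_level using level_k by (intro sum.cong refl)
  also have "\<dots> = - (\<Sum>k=1..n. a k * cos_prod n k u * tail_sum n c (k - 1) * sin (u k) * sphere_along n k u w)
      + (T n - T 0)"
    unfolding sum.distrib telescope sum_negf ..
  finally show ?thesis by (simp add: T_def dcos_along_top)
qed

text \<open>
  The radial part of \<open>L F = 0\<close> on level \<open>k\<close>, obtained by pairing with the vector \<open>\<phi>\<close>. Of the
  two parameters of the level, \<open>A\<^sub>k\<close> multiplies \<open>L C\<^sub>k\<close> and \<open>A\<^sub>k\<^sub>-\<^sub>1\<close> multiplies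
  \<open>L C\<^sub>k\<^sub>-\<^sub>1 = L (C\<^sub>k cos u\<^sup>k)\<close>; what remains is \<open>L (C\<^sub>k sin u\<^sup>k)\<close>.
\<close>

lemma level_defect_relation:
  assumes eq: "\<And>l. l < m \<Longrightarrow> second_diagonal c l = along t l" and k: "k \<in> {1..<n}"
  shows "A k * level_defect n u c t k =
    A (k - 1) * cos (u k) * level_defect n u c t (k - 1) + a k * sin (u k) * sphere_defect n u c t k"
proof -
  define C s cc D B where "C = cos_prod n k u" and "s = sin (u k)" and "cc = cos (u k)"
    and "D = dcos_along n k u t" and "B = tail_sum n c k"
  have kn: "k \<in> {1..n}" using k by simp
  have "(\<Sum>l | l < m \<and> \<kappa> l = k. \<phi> l (u k) * second_diagonal c l) = (\<Sum>l | l < m \<and> \<kappa> l = k. \<phi> l (u k) * along t l)"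
    using eq by (intro sum.cong) auto
  moreover have "(\<Sum>l | l < m \<and> \<kappa> l = k. \<phi> l (u k) * second_diagonal c l) =
      C * c k * (\<Sum>l | l < m \<and> \<kappa> l = k. \<phi> l (u k) * deriv (deriv (\<phi> l)) (u k))
      - C * B * (\<Sum>l | l < m \<and> \<kappa> l = k. \<phi> l (u k) * \<phi> l (u k))"
    unfolding sum_distrib_left sum_subtractf[symmetric]
    by (intro sum.cong refl) (auto simp: second_eq C_def B_def algebra_simps)
  moreover have "(\<Sum>l | l < m \<and> \<kappa> l = k. \<phi> l (u k) * along t l) =
      D * (\<Sum>l | l < m \<and> \<kappa> l = k. \<phi> l (u k) * \<phi> l (u k))
      + C * t k * (\<Sum>l | l < m \<and> \<kappa> l = k. \<phi> l (u k) * deriv (\<phi> l) (u k))"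
    unfolding sum_distrib_left sum.distrib[symmetric]
    by (intro sum.cong refl) (auto simp: along_eq C_def D_def algebra_simps)
  ultimately have "C * c k * (- (a k * s\<^sup>2 + A (k - 1) * cc\<^sup>2)) - C * B * (a k * s\<^sup>2 + A (k - 1) * cc\<^sup>2 - A k) =
      D * (a k * s\<^sup>2 + A (k - 1) * cc\<^sup>2 - A k) + C * t k * ((a k - A (k - 1)) * s * cc)"
    unfolding sum_radius[OF k] sum_radial_velocity[OF k] sum_radial_acceleration[OF k]
    by (simp add: s_def cc_def)
  then show ?thesis
    unfolding level_defect_pred[OF kn] sphere_defect_def
    unfolding level_defect_def C_def[symmetric] s_def[symmetric] cc_def[symmetric] D_def[symmetric] B_def[symmetric]
    by (simp add: power2_eq_square algebra_simps) 
qed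

end

section \<open>Consequences for the fundamental forms\<close>

definition unit_vec_at :: "nat \<Rightarrow> cvec" where
  "unit_vec_at i j = (if j = i then 1 else 0)"

lemma nondegenerate_imp_immersed:
  assumes "nondegenerate_metric_at m n F u"
  shows "immersed_at m n F u"
  unfolding immersed_at_def lin_indep_def
proof (intro allI impI)
  fix c assume c: "\<forall>l\<in>{..<m}. (\<Sum>j=1..n. c j * tangent F u j l) = 0"
  have "(\<Sum>j=1..n. c j * gram m F u j i) = 0" for i
  proof -
    have "(\<Sum>j=1..n. c j * gram m F u j i) = (\<Sum>l<m. (\<Sum>j=1..n. c j * tangent F u j l) * tangent F u i l)"
      unfolding gram_def sum_distrib_left sum_distrib_right by (subst sum.swap) (simp add: mult.assoc)
    also have "\<dots> = 0" using c by simp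
    finally show ?thesis .
  qed
  then show "\<forall>j\<in>{1..n}. c j = 0"
    using assms unfolding nondegenerate_metric_at_def lin_indep_def by blast
qed

context warped_map
begin

lemma along_unit: "i \<in> {1..n} \<Longrightarrow> along (unit_vec_at i) l = tangent F u i l"
  unfolding along_def unit_vec_at_def by (simp add: if_distrib cong: if_cong)

text \<open>
  Where \<open>cos u\<^sup>j = 0\<close>, the relation for mixed derivatives forces \<open>\<partial>\<^sub>i F = 0\<close>.
\<close>

lemma immersed_cos_nonzero:
  assumes "immersed_at m n F u" and ij: "i \<in> {1..n}" "j \<in> {1..n}" "i < j"
  shows "cos (u j) \<noteq> 0"
proof
  assume c0: "cos (u j) = 0"
  then have "sin (u j) \<noteq> 0" using sin_cos_squared_add[of "u j"] by auto
  then have "tangent F u i l = 0" if "l < m" for l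
    using mixed_second_derivative(1)[OF that ij] c0 by simp
  then have "\<forall>l\<in>{..<m}. (\<Sum>k=1..n. unit_vec_at i k * tangent F u k l) = 0"
    using along_unit[OF ij(1)] by (simp add: along_def mult.commute)
  then have "unit_vec_at i i = 0"
    using assms(1) ij(1) unfolding immersed_at_def lin_indep_def by blast
  then show False by (simp add: unit_vec_at_def)
qed

lemma second_form_mixed_zero:
  assumes normal: "normal_at m n F u N" and cos: "cos (u j) \<noteq> 0"
    and ij: "i \<in> {1..n}" "j \<in> {1..n}" "i < j"
  shows "second_form m F u N i j = 0" and "second_form m F u N j i = 0"
proof -
  have N: "(\<Sum>l<m. N l * tangent F u i l) = 0"
    using normal ij(1) by (auto simp: normal_at_def)
  have "cos (u j) * second_form m F u N i j = - sin (u j) * (\<Sum>l<m. N l * tangent F u i l)"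
    unfolding second_form_def sum_distrib_left
    using mixed_second_derivative(1)[OF _ ij, THEN arg_cong, of _ "\<lambda>x. x * N _"]
    by (intro sum.cong refl) (simp only: mult_ac lessThan_iff)
  then show "second_form m F u N i j = 0" using N cos by simp
  have "cos (u j) * second_form m F u N j i = - sin (u j) * (\<Sum>l<m. N l * tangent F u i l)"
    unfolding second_form_def sum_distrib_left
    using mixed_second_derivative(2)[OF _ ij, THEN arg_cong, of _ "\<lambda>x. x * N _"]
    by (intro sum.cong refl) (simp only: mult_ac lessThan_iff)
  then show "second_form m F u N j i = 0" using N cos by simp
qed

lemma lin_element_along: "lin_element m n F u v = (\<Sum>l<m. along v l * along v l)"
  by (simp add: lin_element_def along_def power2_eq_square)

lemma gram_along:
  "i \<in> {1..n} \<Longrightarrow> j \<in> {1..n} \<Longrightarrow> gram m F u i j = (\<Sum>l<m. along (unit_vec_at i) l * along (unit_vec_at j) l)"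
  by (simp add: gram_def along_unit)

lemma normal_along:
  assumes "normal_at m n F u N"
  shows "(\<Sum>l<m. along t l * N l) = 0"
proof -
  have "(\<Sum>l<m. along t l * N l) = (\<Sum>j=1..n. t j * (\<Sum>l<m. N l * tangent F u j l))"
    unfolding along_def sum_distrib_left sum_distrib_right
    by (subst sum.swap) (simp add: mult_ac)
  also have "\<dots> = 0" using assms by (simp add: normal_at_def)
  finally show ?thesis .
qed

lemma along_along_sum:
  assumes "i \<in> {1..n}"
  shows "(\<Sum>l<m. along t l * along (unit_vec_at i) l) = (\<Sum>j=1..n. t j * gram m F u j i)"
  unfolding gram_def along_unit[OF assms]
  unfolding along_def sum_distrib_left sum_distrib_right
  by (subst sum.swap) (simp add: mult_ac)

end

context profiled_map
begin

lemma second_normal: "(\<Sum>l<m. second_diagonal c l * N l) = (\<Sum>j=1..n. c j * second_form m F u N j j)"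
  unfolding second_diagonal_def second_form_def sum_distrib_left sum_distrib_right
  by (subst sum.swap) (simp add: mult_ac)

text \<open>
  If \<open>\<Sum> c\<^sub>j \<partial>\<^sub>j\<^sup>2 F\<close> has no normal part and the same tangential products as \<open>dF(t)\<close>, the two
  agree. The coefficients \<open>t\<close> are an input: the same ones will serve for two different maps.
\<close>

lemma second_eq_along:
  assumes metric: "nondegenerate_metric_at m n F u" and m: "m = n + p"
    and normal: "\<And>k. k \<in> {1..p} \<Longrightarrow> normal_at m n F u (M k)"
    and indep: "lin_indep {1..p} {..<m} M"
    and c: "\<And>k. k \<in> {1..p} \<Longrightarrow> (\<Sum>j=1..n. c j * second_form m F u (M k) j j) = 0"
    and t: "\<And>i. i \<in> {1..n} \<Longrightarrow>
      (\<Sum>l<m. second_diagonal c l * along (unit_vec_at i) l) = (\<Sum>l<m. along t l * along (unit_vec_at i) l)"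
    and l: "l < m"
  shows "second_diagonal c l = along t l"
proof -
  have "second_diagonal c l - along t l = 0"
  proof (rule frame_orthogonal_zero[OF metric m normal indep _ _ l])
    fix i assume i: "i \<in> {1..n}"
    then show "(\<Sum>l<m. (second_diagonal c l - along t l) * tangent F u i l) = 0"
      using t[OF i] along_unit[OF i] by (simp add: left_diff_distrib sum_subtractf)
  next
    fix k assume "k \<in> {1..p}"
    then show "(\<Sum>l<m. (second_diagonal c l - along t l) * M k l) = 0"
      using c second_normal normal_along[OF normal] by (simp add: left_diff_distrib sum_subtractf)
  qed
  then show ?thesis by simp
qed

end

lemma profiled_maps_isometric:
  assumes X: "profiled_map n m \<kappa> \<phi> F u a A" and Y: "profiled_map n m' \<kappa>' \<phi>' F' u a A'"
    and A0: "A 0 = A' 0"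
  shows "(\<Sum>l<m. warped_map.along n F u v l * warped_map.along n F u w l) =
         (\<Sum>l<m'. warped_map.along n F' u v l * warped_map.along n F' u w l)"
  using profiled_map.metric_eq[OF X, of v w] profiled_map.metric_eq[OF Y, of v w] A0 by simp

lemma profiled_maps_same_second_tangential:
  assumes X: "profiled_map n m \<kappa> \<phi> F u a A" and Y: "profiled_map n m' \<kappa>' \<phi>' F' u a A'"
    and A0: "A 0 = A' 0"
  shows "(\<Sum>l<m. profiled_map.second_diagonal n F u c l * warped_map.along n F u w l) =
         (\<Sum>l<m'. profiled_map.second_diagonal n F' u c l * warped_map.along n F' u w l)"
  using profiled_map.tangential_second_eq[OF X, of c w] profiled_map.tangential_second_eq[OF Y, of c w] A0
  by simp

section \<open>The quadric and its deformations\<close>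

definition quadric_profile :: "cvec \<Rightarrow> nat \<Rightarrow> complex \<Rightarrow> complex" where
  "quadric_profile s l t = (if l = 0 then s 0 * cos t else s l * sin t)"

lemma deriv_quadric_profile:
  "deriv (quadric_profile s l) = (\<lambda>t. if l = 0 then - (s 0 * sin t) else s l * cos t)"
  unfolding quadric_profile_def
  by (cases "l = 0") (auto intro!: ext DERIV_imp_deriv derivative_eq_intros)

lemma deriv2_quadric_profile:
  "deriv (deriv (quadric_profile s l)) = (\<lambda>t. - quadric_profile s l t)"
  unfolding deriv_quadric_profile unfolding quadric_profile_def
  by (cases "l = 0") (auto intro!: ext DERIV_imp_deriv derivative_eq_intros)

text \<open>
  The components \<open>0\<close> and \<open>1\<close> share the first level, because \<open>C\<^sub>0 = cos u\<^sup>1 C\<^sub>1\<close>.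
\<close>

lemma quadric_warped: 
  assumes "n \<ge> 2"
  shows "warped_map n (n + 1) (max 1) (quadric_profile s) (quadric n s) u"
proof
  fix l w assume l: "l < n + 1"
  then show "max 1 l \<in> {1..n}" using assms by auto
  show "quadric n s w l = cos_prod n (max 1 l) w * quadric_profile s l (w (max 1 l))"
    using cos_prod_pred[of 1 n w] assms by (auto simp: quadric_def quadric_profile_def max_def)
  have "quadric_profile s l holomorphic_on UNIV"
    unfolding quadric_profile_def by (cases "l = 0") (auto intro!: holomorphic_intros)
  then show "quadric_profile s l analytic_on {u (max 1 l)}"
    by (auto intro: holomorphic_on_imp_analytic_at)
qed

lemma quadric_profiled: 
  assumes n: "n \<ge> 2" and s: "\<forall>j\<le>n. (s j)\<^sup>2 = a j"
  shows "profiled_map n (n + 1) (max 1) (quadric_profile s) (quadric n s) u a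
    (\<lambda>k. if k = 0 then a 0 else 0)"
proof -
  interpret warped_map n "n + 1" "max 1" "quadric_profile s" "quadric n s" u
    by (rule quadric_warped[OF n])
  have fibre: "{l. l < n + 1 \<and> max 1 l = k} = (if k = 1 then {0, 1} else {k})" if "k \<in> {1..n}" for k
    using that by (auto simp: max_def split: if_splits)
  show ?thesis
  proof
    fix k assume k: "k \<in> {1..<n}"
    then have k': "k \<in> {1..n}" by auto
    show "\<forall>\<^sub>F t in nhds (u k). (\<Sum>l | l < n + 1 \<and> max 1 l = k. (quadric_profile s l t)\<^sup>2) =
        a k * (sin t)\<^sup>2 + (if k - 1 = 0 then a 0 else 0) * (cos t)\<^sup>2 - (if k = 0 then a 0 else 0)"
      unfolding fibre[OF k'] using s k
      by (intro always_eventually allI) (auto simp: quadric_profile_def power_mult_distrib)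
  next
    fix k assume k: "k \<in> {1..n}"
    show "\<forall>\<^sub>F t in nhds (u k). (\<Sum>l | l < n + 1 \<and> max 1 l = k. (deriv (quadric_profile s l) t)\<^sup>2) =
        a k * (cos t)\<^sup>2 + (if k - 1 = 0 then a 0 else 0) * (sin t)\<^sup>2"
      unfolding fibre[OF k] using s k n
      by (intro always_eventually allI) (auto simp: deriv_quadric_profile power_mult_distrib)
  qed
qed

definition deformation_profile ::
  "nat \<Rightarrow> (nat \<Rightarrow> complex \<Rightarrow> complex) \<Rightarrow> (nat \<Rightarrow> complex \<Rightarrow> complex) \<Rightarrow> (complex \<Rightarrow> complex) \<Rightarrow>
   nat \<Rightarrow> complex \<Rightarrow> complex" where
  "deformation_profile n f g h l t =
     (if l = 2 * n - 2 then h t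
      else f (l div 2 + 1) t * (if even l then cos (g (l div 2 + 1) t) else sin (g (l div 2 + 1) t)))"

text \<open>
  The parameters \<open>A\<^sub>k = z\<^sub>k a\<^sub>0\<close> of the profile, with \<open>z\<^sub>0 = 1\<close>.
\<close>

definition branch_param :: "cvec \<Rightarrow> cvec \<Rightarrow> nat \<Rightarrow> complex" where
  "branch_param a z k = par z k * a 0"

lemma f_radicand_param:
  "f_radicand a z k t =
    a k * (sin t)\<^sup>2 + branch_param a z (k - 1) * (cos t)\<^sup>2 - branch_param a z k"
  unfolding f_radicand_def branch_param_def cos_squared_eq by (simp add: algebra_simps)

text \<open>
  In polar coordinates the squared speed is \<open>f'\<^sup>2 + f\<^sup>2 g'\<^sup>2\<close>, which equals
  \<open>(F'\<^sup>2 / 4 + r\<^sup>2) / F\<close> for \<open>F = f\<^sup>2\<close> and \<open>g' = r / F\<close>. Only the squares of the chosen roots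
  enter, so the choice of branches is immaterial.
\<close>

lemma profile_speed:
  assumes f: "(f has_field_derivative f') (at t)" and g: "(g has_field_derivative r / F) (at t)"
    and ff: "2 * f t * f' = F'" and F: "(f t)\<^sup>2 = F" "F \<noteq> 0"
    and speed: "F'\<^sup>2 + 4 * r\<^sup>2 = 4 * F * E"
  shows "(deriv (\<lambda>t. f t * cos (g t)) t)\<^sup>2 + (deriv (\<lambda>t. f t * sin (g t)) t)\<^sup>2 = E"
proof -
  have c: "deriv (\<lambda>t. f t * cos (g t)) t = f' * cos (g t) - f t * sin (g t) * (r / F)"
    and s: "deriv (\<lambda>t. f t * sin (g t)) t = f' * sin (g t) + f t * cos (g t) * (r / F)"
    by (rule DERIV_imp_deriv, (rule f g derivative_eq_intros refl | simp add: algebra_simps)+)+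
  have "(deriv (\<lambda>t. f t * cos (g t)) t)\<^sup>2 + (deriv (\<lambda>t. f t * sin (g t)) t)\<^sup>2 =
      (f'\<^sup>2 + (f t)\<^sup>2 * (r / F)\<^sup>2) * ((sin (g t))\<^sup>2 + (cos (g t))\<^sup>2)"
    unfolding c s by (simp only: power2_eq_square) (simp only: algebra_simps)
  also have "\<dots> = f'\<^sup>2 + r\<^sup>2 / F"
    using F by (simp add: power_divide) (simp add: power2_eq_square)
  also have "\<dots> = E"
  proof -
    have "4 * F * (f'\<^sup>2 + r\<^sup>2 / F) = (2 * f t * f')\<^sup>2 + 4 * r\<^sup>2"
      using F by (simp add: power_mult_distrib distrib_left)
    then have "4 * F * (f'\<^sup>2 + r\<^sup>2 / F) = 4 * F * E" using ff speed by simp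
    then show ?thesis using F(2) by simp
  qed
  finally show ?thesis .
qed

lemma deformation_fibre:
  fixes k n :: nat
  assumes "k \<in> {1..n}"
  shows "{l. l < 2 * n - 1 \<and> l div 2 + 1 = k} = (if k = n then {2 * n - 2} else {2 * k - 2, 2 * k - 1})"
  using assms by (auto; presburger)

text \<open>
  The radius is the definition of \<open>f\<^sub>k\<close>; the radicand of \<open>g\<^sub>k\<close> is chosen to produce the speed,
  and the radicand of \<open>h\<close> is the squared speed on the last level itself. The speed relation
  requires \<open>f\<^sub>k \<noteq> 0\<close>, which persists near a point of the domain.
\<close>

lemma deformation_profiled:
  assumes n: "n \<ge> 2" and br: "branches n a z b D f r g h" and u: "u \<in> valid_domain n D f"
  shows "profiled_map n (2 * n - 1) (\<lambda>l. l div 2 + 1) (deformation_profile n f g h)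
    (deformation n f g h) u a (branch_param a z)"
proof -
  have D: "open (D k)" "connected (D k)" if "k \<in> {1..n}" for k
    using br that by (auto simp: branches_def)
  have uD: "u k \<in> D k" if "k \<in> {1..n}" for k
    using u that by (auto simp: valid_domain_def)
  have f: "sqrt_branch (D k) (f_radicand a z k) (f k)"
    and r: "sqrt_branch (D k) (g_radicand a z k) (r k)"
    and g: "\<And>t. t \<in> D k \<Longrightarrow> (g k has_field_derivative r k t / f_radicand a z k t) (at t)"
    and f0: "f k (u k) \<noteq> 0" if "k \<in> {1..<n}" for k
    using br u that D[of k]
    by (auto simp: branches_def valid_domain_def intro!: integral_from_has_field_derivative)
  have rn: "sqrt_branch (D n) (h_radicand n a z) (r n)"
    and h: "\<And>t. t \<in> D n \<Longrightarrow> (h has_field_derivative r n t) (at t)"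
    using br n D[of n] by (auto simp: branches_def intro!: integral_from_has_field_derivative)
  have f_hol: "f k holomorphic_on D k" if "k \<in> {1..<n}" for k
    using f[OF that] by (simp add: sqrt_branch_def)
  have g_hol: "g k holomorphic_on D k" if "k \<in> {1..<n}" for k
    using g[OF that] D(1)[of k] that holomorphic_on_open by auto
  have h_hol: "h holomorphic_on D n"
    using h D(1)[of n] n holomorphic_on_open by auto
  interpret warped_map n "2 * n - 1" "\<lambda>l. l div 2 + 1" "deformation_profile n f g h" "deformation n f g h" u
  proof
    fix l w assume l: "l < 2 * n - 1"
    then show k: "l div 2 + 1 \<in> {1..n}" by auto
    show "deformation n f g h w l =
        cos_prod n (l div 2 + 1) w * deformation_profile n f g h l (w (l div 2 + 1))"
    proof (cases "l = 2 * n - 2")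
      case True
      then have "l div 2 + 1 = n" using n by auto
      then show ?thesis using True by (simp add: deformation_def deformation_profile_def cos_prod_def)
    qed (simp add: deformation_def deformation_profile_def)
    show "deformation_profile n f g h l analytic_on {u (l div 2 + 1)}"
    proof (cases "l = 2 * n - 2")
      case True
      then have "l div 2 + 1 = n" "deformation_profile n f g h l = h"
        using n by (auto simp: deformation_profile_def)
      then show ?thesis
        using holomorphic_on_imp_analytic_at[OF h_hol D(1)[of n] uD[of n]] n by auto
    next
      case False
      then have k': "l div 2 + 1 \<in> {1..<n}" using l by auto
      have "deformation_profile n f g h l holomorphic_on D (l div 2 + 1)"
        unfolding deformation_profile_def using False f_hol[OF k'] g_hol[OF k']
        by (cases "even l") (auto intro!: holomorphic_intros)
      then show ?thesis using D(1)[OF k] uD[OF k] by (rule holomorphic_on_imp_analytic_at)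
    qed
  qed
  have plane: "deformation_profile n f g h (2 * k - 2) = (\<lambda>t. f k t * cos (g k t))"
    "deformation_profile n f g h (2 * k - 1) = (\<lambda>t. f k t * sin (g k t))"
    if "k \<in> {1..<n}" for k
  proof -
    have "2 * k - 2 \<noteq> 2 * n - 2" "2 * k - 1 \<noteq> 2 * n - 2" "(2 * k - 2) div 2 + 1 = k"
      "(2 * k - 1) div 2 + 1 = k" "even (2 * k - 2)" "odd (2 * k - 1)"
      using that by (auto; presburger)+
    then show "deformation_profile n f g h (2 * k - 2) = (\<lambda>t. f k t * cos (g k t))"
      "deformation_profile n f g h (2 * k - 1) = (\<lambda>t. f k t * sin (g k t))"
      by (simp_all only: fun_eq_iff deformation_profile_def if_False if_True simp_thms)
  qed
  have ne: "2 * k - 2 \<noteq> 2 * k - 1" if "k \<ge> 1" for k :: nat using that by auto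
  show ?thesis
  proof
    fix k assume k: "k \<in> {1..<n}"
    then have k': "k \<in> {1..n}" and kn: "k \<noteq> n" by auto
    have "(\<Sum>l | l < 2 * n - 1 \<and> l div 2 + 1 = k. (deformation_profile n f g h l t)\<^sup>2) =
        a k * (sin t)\<^sup>2 + branch_param a z (k - 1) * (cos t)\<^sup>2 - branch_param a z k" if t: "t \<in> D k" for t
    proof -
      have "(\<Sum>l | l < 2 * n - 1 \<and> l div 2 + 1 = k. (deformation_profile n f g h l t)\<^sup>2) =
          (f k t)\<^sup>2 * ((cos (g k t))\<^sup>2 + (sin (g k t))\<^sup>2)"
        unfolding deformation_fibre[OF k'] using kn ne[of k] k plane[OF k]
        by (simp add: power_mult_distrib flip: distrib_left)
      then show ?thesis using f[OF k] t by (simp add: sqrt_branch_def f_radicand_param)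
    qed
    then show "\<forall>\<^sub>F t in nhds (u k). (\<Sum>l | l < 2 * n - 1 \<and> l div 2 + 1 = k. (deformation_profile n f g h l t)\<^sup>2) =
        a k * (sin t)\<^sup>2 + branch_param a z (k - 1) * (cos t)\<^sup>2 - branch_param a z k"
      using D(1)[OF k'] uD[OF k'] unfolding eventually_nhds by blast
  next
    fix k assume k: "k \<in> {1..n}"
    show "\<forall>\<^sub>F t in nhds (u k). (\<Sum>l | l < 2 * n - 1 \<and> l div 2 + 1 = k. (deriv (deformation_profile n f g h l) t)\<^sup>2) =
        a k * (cos t)\<^sup>2 + branch_param a z (k - 1) * (sin t)\<^sup>2"
    proof (cases "k = n")
      case True
      have "deformation_profile n f g h (2 * n - 2) = h"
        by (auto simp: deformation_profile_def)
      then have "(\<Sum>l | l < 2 * n - 1 \<and> l div 2 + 1 = k. (deriv (deformation_profile n f g h l) t)\<^sup>2) =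
          a k * (cos t)\<^sup>2 + branch_param a z (k - 1) * (sin t)\<^sup>2" if t: "t \<in> D k" for t
        unfolding deformation_fibre[OF k] using True rn t DERIV_imp_deriv[OF h]
        by (simp add: sqrt_branch_def h_radicand_def branch_param_def cos_squared_eq algebra_simps)
      then show ?thesis using D(1)[OF k] uD[OF k] unfolding eventually_nhds by blast
    next
      case False
      then have k': "k \<in> {1..<n}" using k by auto
      have sp: "(\<Sum>l | l < 2 * n - 1 \<and> l div 2 + 1 = k. (deriv (deformation_profile n f g h l) t)\<^sup>2) =
          a k * (cos t)\<^sup>2 + branch_param a z (k - 1) * (sin t)\<^sup>2" if t: "t \<in> D k" and ft: "f k t \<noteq> 0" for t
      proof -
        define A B s c where "A = branch_param a z (k - 1)" and "B = branch_param a z k"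
          and "s = sin t" and "c = cos t"
        have sc: "c\<^sup>2 = 1 - s\<^sup>2" by (simp add: s_def c_def cos_squared_eq)
        have F: "f_radicand a z k t = A - B + (a k - A) * s\<^sup>2"
          by (simp add: f_radicand_def A_def B_def branch_param_def s_def algebra_simps)
        have f': "(f k has_field_derivative deriv (f k) t) (at t)"
          using f_hol[OF k'] D(1)[OF k] t by (rule holomorphic_derivI)
        have "(f_radicand a z k has_field_derivative 2 * (a k - A) * s * c) (at t)"
          unfolding f_radicand_def A_def branch_param_def s_def c_def
          by (auto intro!: derivative_eq_intros)
        then have ff: "2 * f k t * deriv (f k) t = 2 * (a k - A) * s * c"
          using sqrt_branch_deriv[OF f[OF k'] D(1)[OF k] t] by blast
        have f2: "(f k t)\<^sup>2 = f_radicand a z k t" and r2: "(r k t)\<^sup>2 = (A - B) * a k + (a k - A) * B * s\<^sup>2"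
          using f[OF k'] r[OF k'] t
          by (auto simp: sqrt_branch_def g_radicand_def A_def B_def branch_param_def s_def algebra_simps)
        have "(2 * (a k - A) * s * c)\<^sup>2 + 4 * (r k t)\<^sup>2 = 4 * f_radicand a z k t * (a k * c\<^sup>2 + A * s\<^sup>2)"
          unfolding r2 F power_mult_distrib sc by (simp add: power2_eq_square algebra_simps)
        then have "(deriv (\<lambda>t. f k t * cos (g k t)) t)\<^sup>2 + (deriv (\<lambda>t. f k t * sin (g k t)) t)\<^sup>2 = a k * c\<^sup>2 + A * s\<^sup>2"
          using ft f2 by (intro profile_speed[OF f' g[OF k' t] ff f2]) auto
        then show ?thesis
          unfolding deformation_fibre[OF k] using False ne[of k] k plane[OF k']
          by (simp add: A_def s_def c_def)
      qed
      have "continuous_on (D k) (f k)" using f_hol[OF k'] by (rule holomorphic_on_imp_continuous_on)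
      then have "open (D k \<inter> f k -` (- {0}))"
        using D(1)[OF k] by (intro continuous_open_preimage) auto
      then show ?thesis
        using sp uD[OF k] f0[OF k'] unfolding eventually_nhds
        by (intro exI[of _ "D k \<inter> f k -` (- {0})"]) auto
    qed
  qed
qed

section \<open>Independence of the joined second fundamental forms\<close>

text \<open>
  On the quadric \<open>L\<close> can be read off componentwise: the components are non-zero multiples of
  \<open>C\<^sub>0\<close> and of \<open>C\<^sub>k sin u\<^sup>k\<close>.
\<close>

lemma quadric_second_along:
  assumes n: "n \<ge> 2" and s: "\<forall>j\<le>n. (s j)\<^sup>2 = a j" and nz: "\<forall>j\<le>n. a j \<noteq> 0"
    and eq: "\<And>l. l < n + 1 \<Longrightarrow>
      profiled_map.second_diagonal n (quadric n s) u c l = warped_map.along n (quadric n s) u t l"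
  shows "level_defect n u c t 0 = 0"
    and "\<And>k. k \<in> {1..n} \<Longrightarrow> sphere_defect n u c t k = 0"
proof -
  interpret profiled_map n "n + 1" "max 1" "quadric_profile s" "quadric n s" u a "\<lambda>k. if k = 0 then a 0 else 0"
    by (rule quadric_profiled[OF n s])
  have s0: "s j \<noteq> 0" if "j \<le> n" for j using s nz that by fastforce
  have eq': "cos_prod n (max 1 l) u * (c (max 1 l) + tail_sum n c (max 1 l)) * quadric_profile s l (u (max 1 l))
      + dcos_along n (max 1 l) u t * quadric_profile s l (u (max 1 l))
      + cos_prod n (max 1 l) u * t (max 1 l) * deriv (quadric_profile s l) (u (max 1 l)) = 0" (is "?e l = 0")
    if "l < n + 1" for l
  proof -
    have "?e l = along t l - second_diagonal c l"
      unfolding second_eq[OF that] along_eq[OF that] deriv2_quadric_profile by (simp add: algebra_simps)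
    then show ?thesis using eq[OF that] by simp
  qed
  have "s 0 * (cos (u 1) * (level_defect n u c t 1 - cos_prod n 1 u * c 1) + sin (u 1) * cos_prod n 1 u * t 1) = - ?e 0"
    unfolding deriv_quadric_profile by (simp add: level_defect_def quadric_profile_def algebra_simps)
  also have "- ?e 0 = 0" using eq'[of 0] by (simp only: neg_equal_0_iff_equal)
  finally have "s 0 * level_defect n u c t 0 = 0"
    using level_defect_pred[of 1 n u c t] n by simp
  then show "level_defect n u c t 0 = 0" using s0[of 0] by simp
  fix k assume k: "k \<in> {1..n}"
  then have kk: "max 1 k = k" by auto
  then have "s k * sphere_defect n u c t k = - ?e k"
    using k unfolding deriv_quadric_profile
    by (simp add: quadric_profile_def level_defect_def sphere_defect_def algebra_simps)
  also have "?e k = 0" using eq'[of k] k by simp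
  finally have "s k * sphere_defect n u c t k = 0" by simp
  then show "sphere_defect n u c t k = 0" using s0[of k] k by simp
qed

text \<open>
  A relation \<open>c\<close> makes \<open>\<Sum> c\<^sub>j \<partial>\<^sub>j\<^sup>2\<close> tangent for both maps, with the same coefficients \<open>t\<close> since the
  metric and the tangential products agree. The quadric gives \<open>L C\<^sub>0 = 0\<close> and
  \<open>L (C\<^sub>k sin u\<^sup>k) = 0\<close>, the deformation propagates \<open>L C\<^sub>k = 0\<close> from one level to the next as
  long as \<open>A\<^sub>k \<noteq> 0\<close>, and then the vanishing of \<open>L\<close> on \<open>C\<^sub>k cos u\<^sup>k\<close> and \<open>C\<^sub>k sin u\<^sup>k\<close> leaves
  only \<open>c\<^sub>k = t\<^sub>k = 0\<close>.
\<close>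

lemma joined_form_nondegenerate:
  assumes n: "n \<ge> 2" and s: "\<forall>j\<le>n. (s j)\<^sup>2 = a j" and nz: "\<forall>j\<le>n. a j \<noteq> 0"
    and Y: "profiled_map n (2 * n - 1) \<kappa> \<phi> Y u a A" and A0: "A 0 = a 0"
    and A: "\<And>k. k \<in> {1..<n} \<Longrightarrow> A k \<noteq> 0"
    and metric: "nondegenerate_metric_at (n + 1) n (quadric n s) u"
    and data: "normal_data n (quadric n s) Y u N NY"
  shows "lin_indep {1..n} {..<n} (\<lambda>j. joined_form n (quadric n s) Y u N NY j j)"
  unfolding lin_indep_def
proof (intro allI impI)
  fix c assume c: "\<forall>i\<in>{..<n}. (\<Sum>j=1..n. c j * joined_form n (quadric n s) Y u N NY j j i) = 0"
  \<comment> \<open>the quadric is the member of the family with the parameters \<open>a\<^sub>0, 0, \<dots>, 0\<close>\<close>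
  define A1 where "A1 k = (if k = 0 then a 0 else 0)" for k :: nat
  have X: "profiled_map n (n + 1) (max 1) (quadric_profile s) (quadric n s) u a A1"
    unfolding A1_def by (rule quadric_profiled[OF n s])
  interpret X: profiled_map n "n + 1" "max 1" "quadric_profile s" "quadric n s" u a A1 by (rule X)
  interpret Y: profiled_map n "2 * n - 1" \<kappa> \<phi> Y u a A by (rule Y)
  have A10: "A1 0 = A 0" using A0 by (simp add: A1_def)
  note iso = profiled_maps_isometric[OF X Y A10] profiled_maps_same_second_tangential[OF X Y A10]
  have "gram (2 * n - 1) Y u i j = gram (n + 1) (quadric n s) u i j" if "i \<in> {1..n}" "j \<in> {1..n}" for i j
    unfolding X.gram_along[OF that] Y.gram_along[OF that] by (rule iso(1)[symmetric])
  then have metricY: "nondegenerate_metric_at (2 * n - 1) n Y u"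
    using metric unfolding nondegenerate_metric_at_def lin_indep_def by simp
  \<comment> \<open>the tangential part of \<open>\<Sum> c\<^sub>j \<partial>\<^sub>j\<^sup>2 X\<close>; the metric being non-degenerate, it exists\<close>
  obtain t where t: "\<forall>i\<in>{1..n}. (\<Sum>j=1..n. t j * gram (n + 1) (quadric n s) u j i) =
      (\<Sum>l<n+1. X.second_diagonal c l * X.along (unit_vec_at i) l)"
    using lin_indep_square_solve[OF _ _ _ metric[unfolded nondegenerate_metric_at_def],
        of "\<lambda>i. \<Sum>l<n+1. X.second_diagonal c l * X.along (unit_vec_at i) l"] by auto
  have X_eq: "X.second_diagonal c l = X.along t l" if "l < n + 1" for l
  proof (rule X.second_eq_along[OF metric, of 1 "\<lambda>_. N"])
    show "lin_indep {1..1} {..<n + 1} (\<lambda>_. N)"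
      using data by (auto simp: normal_data_def lin_indep_def)
    show "(\<Sum>j=1..n. c j * second_form (n + 1) (quadric n s) u N j j) = 0"
      using c[rule_format, of 0] n by (simp add: joined_form_def)
    show "(\<Sum>l<n+1. X.second_diagonal c l * X.along (unit_vec_at i) l) =
        (\<Sum>l<n+1. X.along t l * X.along (unit_vec_at i) l)" if "i \<in> {1..n}" for i
      using t that X.along_along_sum[OF that, of t] by simp
  qed (use data that in \<open>auto simp: normal_data_def\<close>)
  have Y_eq: "Y.second_diagonal c l = Y.along t l" if "l < 2 * n - 1" for l
  proof (rule Y.second_eq_along[OF metricY, of "n - 1" NY])
    have "{1..n - 1} = {1..<n}" using n by auto
    then show "lin_indep {1..n - 1} {..<2 * n - 1} NY"
      using data by (simp add: normal_data_def)
    show "(\<Sum>j=1..n. c j * second_form (2 * n - 1) Y u (NY k) j j) = 0" if "k \<in> {1..n - 1}" for k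
      using c[rule_format, of k] that n by (auto simp: joined_form_def)
    show "(\<Sum>l<2 * n - 1. Y.second_diagonal c l * Y.along (unit_vec_at i) l) =
        (\<Sum>l<2 * n - 1. Y.along t l * Y.along (unit_vec_at i) l)" if "i \<in> {1..n}" for i
      using t that X.along_along_sum[OF that, of t] iso by simp
  qed (use data that n in \<open>auto simp: normal_data_def\<close>)
  have defects: "level_defect n u c t 0 = 0" "\<And>k. k \<in> {1..n} \<Longrightarrow> sphere_defect n u c t k = 0"
    using quadric_second_along[OF n s nz, of u c t] X_eq by blast+
  have level: "k \<le> n \<Longrightarrow> level_defect n u c t k = 0" for k
  proof (induction k)
    case 0
    then show ?case using defects(1) by simp
  next
    case (Suc k)
    show ?case
    proof (cases "Suc k = n")
      case True
      then show ?thesis using level_defect_top by metis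
    next
      case False
      then have k: "Suc k \<in> {1..<n}" using Suc.prems by auto
      then have "A (Suc k) * level_defect n u c t (Suc k) = 0"
        using Y.level_defect_relation[OF Y_eq k] Suc defects(2)[of "Suc k"] by auto
      then show ?thesis using A[OF k] by simp
    qed
  qed
  show "\<forall>j\<in>{1..n}. c j = 0"
  proof
    fix k assume k: "k \<in> {1..n}"
    have C: "cos_prod n k u \<noteq> 0"
      unfolding cos_prod_def
      using X.immersed_cos_nonzero[OF nondegenerate_imp_immersed[OF metric] k] k by auto
    have "cos (u k) * (cos_prod n k u * c k) - sin (u k) * (cos_prod n k u * t k) = 0"
      using level_defect_pred[OF k, of u c t] level[of k] level[of "k - 1"] k by (auto simp: algebra_simps)
    moreover have "sin (u k) * (cos_prod n k u * c k) + cos (u k) * (cos_prod n k u * t k) = 0"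
      using defects(2)[OF k] level[of k] k
      by (simp add: sphere_defect_def algebra_simps neg_eq_iff_add_eq_0 flip: eq_neg_iff_add_eq_0)
    moreover have "cos_prod n k u * c k =
        ((cos (u k))\<^sup>2 + (sin (u k))\<^sup>2) * (cos_prod n k u * c k)" by simp
    moreover have "\<dots> =
        cos (u k) * (cos (u k) * (cos_prod n k u * c k) - sin (u k) * (cos_prod n k u * t k)) +
        sin (u k) * (sin (u k) * (cos_prod n k u * c k) + cos (u k) * (cos_prod n k u * t k))"
      unfolding power2_eq_square by (simp only: algebra_simps)
    ultimately have "cos_prod n k u * c k = 0" by (simp only: mult_zero_right add_0_right)
    then show "c k = 0" using C by simp
  qed
qed

lemma generic_parameters_open_dense:
  fixes n :: nat
  defines "Z \<equiv> PiE {1..<n} (\<lambda>_. - {0 :: complex})"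
  shows "openin (param_space n) Z" and "param_space n closure_of Z = topspace (param_space n)"
proof -
  show "openin (param_space n) Z"
    unfolding param_space_def Z_def by (simp add: openin_PiE open_Compl)
  have "closure (- {0 :: complex}) = UNIV" by (simp add: closure_complement)
  then show "param_space n closure_of Z = topspace (param_space n)"
    unfolding param_space_def Z_def closure_of_product_topology by simp
qed

section \<open>All parameters zero\<close>

text \<open>
  The points \<open>f (cos g + \<iota> sin g)\<close> and \<open>\<alpha> cos t + \<iota> \<beta> sin t\<close> have the same logarithmic
  derivative \<open>(F'/2 + \<iota> \<alpha> \<beta>) / F\<close> and the same value at \<open>0\<close>, for either square root \<open>\<iota>\<close> of \<open>-1\<close>. For
  complex arguments the equations for \<open>\<iota> = \<i>\<close> and \<open>\<iota> = - \<i>\<close> are not conjugate to each other, so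
  both are needed to separate cosine and sine.
\<close>

lemma ellipse_polar_coordinates:
  fixes \<alpha> \<beta> :: complex
  defines "F \<equiv> \<lambda>t. \<alpha>\<^sup>2 * (cos t)\<^sup>2 + \<beta>\<^sup>2 * (sin t)\<^sup>2"
  assumes D: "open D" "connected D" and zero: "0 \<in> D"
    and f: "sqrt_branch D F f" "f 0 = \<alpha>" and \<alpha>\<beta>: "\<alpha> \<noteq> 0" "\<beta> \<noteq> 0"
    and g: "\<And>t. t \<in> D \<Longrightarrow> (g has_field_derivative \<alpha> * \<beta> / F t) (at t)" "g 0 = 0"
    and t: "t \<in> D"
  shows "f t * cos (g t) = \<alpha> * cos t" and "f t * sin (g t) = \<beta> * sin t"
proof -
  define F' where "F' t = 2 * (\<beta>\<^sup>2 - \<alpha>\<^sup>2) * sin t * cos t" for t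
  have F': "(F has_field_derivative F' t) (at t)" for t
    unfolding F_def F'_def by (auto intro!: derivative_eq_intros simp: algebra_simps)
  have ff: "2 * f t * deriv f t = F' t" if "t \<in> D" for t
    using sqrt_branch_deriv[OF f(1) D(1) that F'] .
  have f': "(f has_field_derivative deriv f t) (at t)" if "t \<in> D" for t
    using f(1) D(1) that by (auto simp: sqrt_branch_def intro: holomorphic_derivI)
  have f2: "f t * f t = F t" if "t \<in> D" for t
    using f(1) that by (simp add: sqrt_branch_def power2_eq_square)
  \<comment> \<open>a square root of \<open>F\<close> cannot be holomorphic at a zero of \<open>F\<close>, all of which are simple\<close>
  have Fnz: "F t \<noteq> 0" if "t \<in> D" for t
  proof
    assume F0: "F t = 0"
    then have "f t = 0" using f2[OF that] by simp
    then have "F' t = 0" using ff[OF that] by simp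
    then consider "\<beta>\<^sup>2 = \<alpha>\<^sup>2" | "sin t = 0" | "cos t = 0" by (auto simp: F'_def)
    then show False
    proof cases
      case 1
      then have "F t = \<alpha>\<^sup>2 * ((cos t)\<^sup>2 + (sin t)\<^sup>2)" by (simp only: F_def 1 distrib_left)
      then show ?thesis using F0 \<alpha>\<beta> by simp
    next
      case 2
      then show ?thesis using F0 \<alpha>\<beta> sin_cos_squared_add[of t] by (simp add: F_def)
    next
      case 3
      then show ?thesis using F0 \<alpha>\<beta> sin_cos_squared_add[of t] by (simp add: F_def)
    qed
  qed
  have rot: "f t * (cos (g t) + \<iota> * sin (g t)) = \<alpha> * cos t + \<iota> * \<beta> * sin t" if \<iota>: "\<iota> * \<iota> = -1" for \<iota>
  proof -
    define p where "p t = f t * (cos (g t) + \<iota> * sin (g t))" for t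
    define w where "w t = \<alpha> * cos t + \<iota> * \<beta> * sin t" for t
    define \<rho> where "\<rho> t = (F' t / 2 + \<iota> * \<alpha> * \<beta>) / F t" for t
    have ww: "w t * (\<alpha> * cos t - \<iota> * \<beta> * sin t) = F t" for t
    proof -
      have "w t * (\<alpha> * cos t - \<iota> * \<beta> * sin t) = \<alpha>\<^sup>2 * (cos t)\<^sup>2 - (\<iota> * \<iota>) * \<beta>\<^sup>2 * (sin t)\<^sup>2"
        unfolding w_def power2_eq_square by (simp only: algebra_simps)
      then show ?thesis by (simp add: \<iota> F_def)
    qed
    have w': "(w has_field_derivative \<rho> t * w t) (at t)" if "t \<in> D" for t
    proof -
      have "F t * (- (\<alpha> * sin t) + \<iota> * \<beta> * cos t) =
          w t * ((\<alpha> * cos t - \<iota> * \<beta> * sin t) * (- (\<alpha> * sin t) + \<iota> * \<beta> * cos t))"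
        by (simp only: ww[symmetric] mult.assoc)
      also have "(\<alpha> * cos t - \<iota> * \<beta> * sin t) * (- (\<alpha> * sin t) + \<iota> * \<beta> * cos t) =
          \<iota> * \<alpha> * \<beta> * ((cos t)\<^sup>2 + (sin t)\<^sup>2) - (\<iota> * \<iota>) * \<beta>\<^sup>2 * sin t * cos t - \<alpha>\<^sup>2 * sin t * cos t"
        unfolding power2_eq_square by (simp add: algebra_simps del: sin_cos_squared_add3)
      also have "\<dots> = F' t / 2 + \<iota> * \<alpha> * \<beta>"
      proof -
        have "F' t / 2 = (\<beta>\<^sup>2 - \<alpha>\<^sup>2) * sin t * cos t" by (simp add: F'_def)
        then show ?thesis by (simp add: \<iota> algebra_simps)
      qed
      finally have "\<rho> t * w t = - (\<alpha> * sin t) + \<iota> * \<beta> * cos t"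
        using Fnz[OF that] by (simp add: \<rho>_def field_simps)
      then show ?thesis unfolding w_def by (auto intro!: derivative_eq_intros)
    qed
    have p': "(p has_field_derivative \<rho> t * p t) (at t)" if "t \<in> D" for t
    proof -
      let ?e = "cos (g t) + \<iota> * sin (g t)"
      have "(p has_field_derivative
          deriv f t * ?e + f t * ((- sin (g t) + \<iota> * cos (g t)) * (\<alpha> * \<beta> / F t))) (at t)"
        unfolding p_def using f'[OF that] g(1)[OF that]
        by (auto intro!: derivative_eq_intros simp: algebra_simps)
      moreover have "- sin (g t) + \<iota> * cos (g t) = \<iota> * ?e"
        using \<iota> by (simp add: distrib_left mult.assoc[symmetric])
      moreover have df: "deriv f t = F' t / 2 / F t * f t"
      proof -
        have "2 * deriv f t * F t = F' t * f t"
          unfolding ff[OF that, symmetric] f2[OF that, symmetric] by (simp add: mult_ac)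
        then show ?thesis using Fnz[OF that] by (simp add: field_simps)
      qed
      have "deriv f t * e + f t * ((\<iota> * e) * (\<alpha> * \<beta> / F t)) = \<rho> t * (f t * e)" for e
        unfolding df by (simp add: \<rho>_def add_divide_distrib algebra_simps)
      ultimately show ?thesis unfolding p_def by (simp only:)
    qed
    have "w t \<noteq> 0" if "t \<in> D" for t using ww[of t] Fnz[OF that] by auto
    moreover have "p 0 = 1 * w 0" using f(2) g(2) by (simp add: p_def w_def)
    ultimately have "p t = 1 * w t"
      using proportional_log_derivatives[OF D p' w' _ zero _ t] by blast
    then show ?thesis by (simp add: p_def w_def)
  qed
  have rot_i: "f t * (cos (g t) + \<i> * sin (g t)) = \<alpha> * cos t + \<i> * \<beta> * sin t"
    and rot_mi: "f t * (cos (g t) + (- \<i>) * sin (g t)) = \<alpha> * cos t + (- \<i>) * \<beta> * sin t"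
    by (rule rot; simp)+
  have "2 * (f t * cos (g t)) =
      f t * (cos (g t) + \<i> * sin (g t)) + f t * (cos (g t) + (- \<i>) * sin (g t))"
    by (simp add: algebra_simps)
  also have "\<dots> = 2 * (\<alpha> * cos t)"
    unfolding rot_i rot_mi by simp
  finally have "2 * (f t * cos (g t)) = 2 * (\<alpha> * cos t)" .
  moreover have "2 * \<i> * (f t * sin (g t)) =
      f t * (cos (g t) + \<i> * sin (g t)) - f t * (cos (g t) + (- \<i>) * sin (g t))"
    by (simp add: algebra_simps)
  then have "2 * \<i> * (f t * sin (g t)) = 2 * \<i> * (\<beta> * sin t)"
    unfolding rot_i rot_mi by simp
  ultimately show "f t * cos (g t) = \<alpha> * cos t" and "f t * sin (g t) = \<beta> * sin t" by simp_all
qed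

lemma sine_branch_sign:
  assumes "open D" "connected D" "sqrt_branch D \<phi> f" "\<And>t. t \<in> D \<Longrightarrow> \<phi> t = (c * sin t)\<^sup>2"
  obtains \<epsilon> :: complex where "\<epsilon> \<in> {1, -1}" "\<And>t. t \<in> D \<Longrightarrow> f t = \<epsilon> * (c * sin t)"
proof (rule holomorphic_equal_squares[OF assms(1,2), of f "\<lambda>t. c * sin t"])
  show "f holomorphic_on D" using assms(3) by (simp add: sqrt_branch_def)
  show "(\<lambda>t. c * sin t) holomorphic_on D" by (intro holomorphic_intros)
  show "(f t)\<^sup>2 = (c * sin t)\<^sup>2" if "t \<in> D" for t
    using assms(3,4) that by (simp add: sqrt_branch_def)
qed (use that in blast)

text \<open>
  For \<open>z\<^sub>0 = 1\<close>, \<open>z\<^sub>1 = 0\<close> the radicand of \<open>g\<^sub>1\<close> is the constant \<open>a\<^sub>0 a\<^sub>1\<close>, so \<open>f\<^sub>1\<close> and \<open>g\<^sub>1\<close> are the polar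
  coordinates of the ellipse with semi-axes \<open>f\<^sub>1(0)\<close> and \<open>r\<^sub>1(0) / f\<^sub>1(0)\<close>. These are \<open>\<surd>a\<^sub>0\<close> and \<open>\<surd>a\<^sub>1\<close>
  up to signs.
\<close>

lemma zero_parameters_first_plane:
  assumes D: "open D" "connected D" and zero: "0 \<in> D" and a: "a 0 \<noteq> 0" "a 1 \<noteq> 0"
    and z: "z 1 = 0" and s: "(s 0)\<^sup>2 = a 0" "(s 1)\<^sup>2 = a 1"
    and f: "sqrt_branch D (f_radicand a z 1) f" and r: "sqrt_branch D (g_radicand a z 1) r"
    and g: "integral_from 0 D (\<lambda>t. r t / f_radicand a z 1 t) g"
  shows "f 0 / s 0 \<in> {1, -1}" and "r 0 / (f 0 * s 1) \<in> {1, -1}"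
    and "\<And>t. t \<in> D \<Longrightarrow> f t * cos (g t) = f 0 / s 0 * (s 0 * cos t)"
    and "\<And>t. t \<in> D \<Longrightarrow> f t * sin (g t) = r 0 / (f 0 * s 1) * (s 1 * sin t)"
proof -
  define F where "F t = (f 0)\<^sup>2 * (cos t)\<^sup>2 + (r 0 / f 0)\<^sup>2 * (sin t)\<^sup>2" for t
  have s_nz: "s 0 \<noteq> 0" "s 1 \<noteq> 0" using a s by auto
  have f0: "(f 0)\<^sup>2 = a 0" using f zero z by (simp add: sqrt_branch_def f_radicand_def par_def)
  then have f0_nz: "f 0 \<noteq> 0" using a by auto
  have r2: "(r t)\<^sup>2 = (s 0 * s 1)\<^sup>2" if "t \<in> D" for t
    using r that z s by (simp add: sqrt_branch_def g_radicand_def par_def power_mult_distrib)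
  have r_hol: "r holomorphic_on D" using r by (simp add: sqrt_branch_def)
  obtain \<eta> :: complex where "\<eta> \<in> {1, -1}" "\<And>t. t \<in> D \<Longrightarrow> r t = \<eta> * (s 0 * s 1)"
    using holomorphic_equal_squares[OF D r_hol holomorphic_on_const r2] by metis
  then have r_const: "r t = r 0" if "t \<in> D" for t using that zero by simp
  have r0: "(r 0)\<^sup>2 = a 0 * a 1" using r2[OF zero] s by (simp add: power_mult_distrib)
  then have r0_nz: "r 0 \<noteq> 0" using a by auto
  have F: "f_radicand a z 1 = F"
  proof
    fix t
    have "F t = a 0 * (cos t)\<^sup>2 + a 1 * (sin t)\<^sup>2"
      using f0 r0 a by (simp add: F_def power_divide)
    then show "f_radicand a z 1 t = F t"
      using z by (simp add: f_radicand_def par_def cos_squared_eq algebra_simps)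
  qed
  have sq: "(f 0 / s 0)\<^sup>2 = 1" "(r 0 / (f 0 * s 1))\<^sup>2 = 1"
    using f0 r0 s a by (simp_all add: power_divide power_mult_distrib)
  then show "f 0 / s 0 \<in> {1, -1}" "r 0 / (f 0 * s 1) \<in> {1, -1}"
    by (auto simp: power2_eq_1_iff)
  fix t assume t: "t \<in> D"
  have g': "(g has_field_derivative f 0 * (r 0 / f 0) / F x) (at x)" if "x \<in> D" for x
    using integral_from_has_field_derivative[OF g D that] r_const[OF that] f0_nz by (simp flip: F)
  have g0: "g 0 = 0" using integral_from_base[OF g] .
  have *: "f t * cos (g t) = f 0 * cos t" "f t * sin (g t) = r 0 / f 0 * sin t"
    using ellipse_polar_coordinates[OF D zero, of "f 0" "r 0 / f 0" f g t]
      f[unfolded F F_def[abs_def]] f0_nz r0_nz g'[unfolded F_def] g0 t by auto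
  show "f t * cos (g t) = f 0 / s 0 * (s 0 * cos t)" "f t * sin (g t) = r 0 / (f 0 * s 1) * (s 1 * sin t)"
    using * s_nz by auto
qed

text \<open>
  On the levels \<open>2 \<le> k < n\<close> the radicand of \<open>g\<^sub>k\<close> is \<open>0\<close> and that of \<open>f\<^sub>k\<close> is \<open>(s\<^sub>k sin)\<^sup>2\<close>, so the plane
  collapses to a line; on the last level \<open>h' = \<plusminus>s\<^sub>n cos\<close>. Each sign is constant because the
  domains are connected.
\<close>

lemma zero_parameters_quadric:
  assumes n: "n \<ge> 2" and nz: "\<forall>j\<le>n. a j \<noteq> 0" and s: "\<forall>j\<le>n. (s j)\<^sup>2 = a j"
    and br: "branches n a z b D f r g h"
    and z: "\<forall>k\<in>{1..<n}. z k = 0" and b: "\<forall>k\<in>{1..<n}. b k = 0"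
  shows "\<forall>k\<in>{2..<n}. \<forall>t\<in>D k. g k t = 0"
    and "\<exists>\<epsilon>. (\<forall>j\<le>n. \<epsilon> j \<in> {1, -1}) \<and>
           (f 1 0 = s 0 \<and> r 1 0 = s 0 * s 1 \<and> (\<forall>k\<in>{2..<n}. deriv (f k) 0 = s k) \<and> r n 0 = s n
              \<longrightarrow> (\<forall>j\<le>n. \<epsilon> j = 1)) \<and>
           (\<forall>u\<in>valid_domain n D f. \<forall>l<2 * n - 1.
              deformation n f g h u l = quadric_embed (\<lambda>j. \<epsilon> j * quadric n s u j) l)"
proof -
  have D: "open (D k)" "connected (D k)" if "k \<in> {1..n}" for k
    using br that by (auto simp: branches_def)
  have f: "sqrt_branch (D k) (f_radicand a z k) (f k)"
    and r: "sqrt_branch (D k) (g_radicand a z k) (r k)"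
    and g: "integral_from 0 (D k) (\<lambda>t. r k t / f_radicand a z k t) (g k)" if "k \<in> {1..<n}" for k
    using br b that by (auto simp: branches_def)
  have rn: "sqrt_branch (D n) (h_radicand n a z) (r n)" and h: "integral_from 0 (D n) (r n) h"
    using br by (auto simp: branches_def)
  have zero: "0 \<in> D k" if "k \<in> {1..n}" for k
    using g[of k] h that by (cases "k = n") (auto simp: integral_from_def)
  have s_nz: "s j \<noteq> 0" if "j \<le> n" for j using s nz that by fastforce
  have par0: "par z k = 0" if "k \<in> {1..<n}" for k using z that by (simp add: par_def)
  have n_in: "n \<in> {1..n}" and one_in: "1 \<in> {1..<n}" "1 \<in> {1..n}" using n by auto
  show g0: "\<forall>k\<in>{2..<n}. \<forall>t\<in>D k. g k t = 0"
  proof (intro ballI)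
    fix k t assume k: "k \<in> {2..<n}" and t: "t \<in> D k"
    then have k': "k \<in> {1..<n}" "k \<in> {1..n}" "k - 1 \<in> {1..<n}" by auto
    have "(g k has_field_derivative 0) (at x)" if "x \<in> D k" for x
    proof -
      have "r k x = 0"
        using r[OF k'(1)] that par0[OF k'(1)] par0[OF k'(3)] by (simp add: sqrt_branch_def g_radicand_def)
      then show ?thesis
        using integral_from_has_field_derivative[OF g[OF k'(1)] D[OF k'(2)] that] by simp
    qed
    then show "g k t = 0"
      using equal_derivatives_imp_eq[OF D[OF k'(2)], of "g k" "\<lambda>_. 0" "\<lambda>_. 0" 0 t] zero[OF k'(2)] t
        integral_from_base[OF g[OF k'(1)]] by simp
  qed
  \<comment> \<open>the signs are read off at \<open>0\<close>, so that matching choices of roots visibly give \<open>1\<close>\<close>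
  define \<epsilon> where "\<epsilon> j = (if j = 0 then f 1 0 / s 0 else if j = 1 then r 1 0 / (f 1 0 * s 1)
      else if j < n then deriv (f j) 0 / s j else r n 0 / s n)" for j
  have plane1: "\<epsilon> 0 \<in> {1, -1}" "\<epsilon> 1 \<in> {1, -1}"
    "\<And>t. t \<in> D 1 \<Longrightarrow> f 1 t * cos (g 1 t) = \<epsilon> 0 * (s 0 * cos t)"
    "\<And>t. t \<in> D 1 \<Longrightarrow> f 1 t * sin (g 1 t) = \<epsilon> 1 * (s 1 * sin t)"
    using zero_parameters_first_plane[OF D[OF one_in(2)] zero[OF one_in(2)], of a z s "f 1" "r 1" "g 1"]
      nz s z n f[OF one_in(1)] r[OF one_in(1)] g[OF one_in(1)] by (auto simp: \<epsilon>_def)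
  have middle: "\<epsilon> k \<in> {1, -1} \<and> (\<forall>t\<in>D k. f k t = \<epsilon> k * (s k * sin t))" if k: "k \<in> {2..<n}" for k
  proof -
    have k': "k \<in> {1..<n}" "k \<in> {1..n}" "k - 1 \<in> {1..<n}" using k by auto
    have "f_radicand a z k t = (s k * sin t)\<^sup>2" for t
      using par0[OF k'(1)] par0[OF k'(3)] s k by (simp add: f_radicand_def power_mult_distrib)
    then obtain e where e: "e \<in> {1, -1}" "\<And>t. t \<in> D k \<Longrightarrow> f k t = e * (s k * sin t)"
      using sine_branch_sign[OF D[OF k'(2)] f[OF k'(1)]] by blast
    have "((\<lambda>t. e * (s k * sin t)) has_field_derivative e * s k) (at 0)"
      by (auto intro!: derivative_eq_intros)
    moreover have "\<forall>\<^sub>F t in nhds 0. f k t = e * (s k * sin t)"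
      using e(2) D(1)[OF k'(2)] zero[OF k'(2)] by (auto simp: eventually_nhds)
    ultimately have "(f k has_field_derivative e * s k) (at 0)"
      using DERIV_cong_ev[OF refl, of "f k" "\<lambda>t. e * (s k * sin t)" 0] by simp
    then have "\<epsilon> k = e" using s_nz[of k] k by (simp add: \<epsilon>_def DERIV_imp_deriv)
    then show ?thesis using e by simp
  qed
  have last: "\<epsilon> n \<in> {1, -1} \<and> (\<forall>t\<in>D n. h t = \<epsilon> n * (s n * sin t))"
  proof -
    have "h_radicand n a z t = (s n * cos t)\<^sup>2" for t
      using par0[of "n - 1"] n s by (simp add: h_radicand_def power_mult_distrib cos_squared_eq algebra_simps)
    then have "(r n t)\<^sup>2 = (s n * cos t)\<^sup>2" if "t \<in> D n" for t
      using rn that by (simp add: sqrt_branch_def)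
    moreover have "r n holomorphic_on D n" using rn by (simp add: sqrt_branch_def)
    moreover have "(\<lambda>t. s n * cos t) holomorphic_on D n" by (intro holomorphic_intros)
    ultimately obtain e where e: "e \<in> {1, -1}" "\<And>t. t \<in> D n \<Longrightarrow> r n t = e * (s n * cos t)"
      using holomorphic_equal_squares[OF D[OF n_in], of "r n" "\<lambda>t. s n * cos t"] by metis
    have "h t = e * (s n * sin t)" if "t \<in> D n" for t
    proof (rule equal_derivatives_imp_eq[OF D[OF n_in] _ _ zero[OF n_in] _ that, where \<phi> = "\<lambda>t. e * (s n * cos t)"])
      show "(h has_field_derivative e * (s n * cos x)) (at x)" if "x \<in> D n" for x
        using integral_from_has_field_derivative[OF h D[OF n_in] that] e(2)[OF that] by simp
      show "((\<lambda>t. e * (s n * sin t)) has_field_derivative e * (s n * cos x)) (at x)" for x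
        by (auto intro!: derivative_eq_intros)
      show "h 0 = e * (s n * sin 0)" using integral_from_base[OF h] by simp
    qed
    moreover have "\<epsilon> n = e" using e(2)[OF zero[OF n_in]] s_nz[of n] n by (simp add: \<epsilon>_def)
    ultimately show ?thesis using e(1) by simp
  qed
  show "\<exists>\<epsilon>. (\<forall>j\<le>n. \<epsilon> j \<in> {1, -1}) \<and>
           (f 1 0 = s 0 \<and> r 1 0 = s 0 * s 1 \<and> (\<forall>k\<in>{2..<n}. deriv (f k) 0 = s k) \<and> r n 0 = s n
              \<longrightarrow> (\<forall>j\<le>n. \<epsilon> j = 1)) \<and>
           (\<forall>u\<in>valid_domain n D f. \<forall>l<2 * n - 1.
              deformation n f g h u l = quadric_embed (\<lambda>j. \<epsilon> j * quadric n s u j) l)"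
  proof (intro exI[of _ \<epsilon>] conjI)
    show "\<forall>j\<le>n. \<epsilon> j \<in> {1, -1}"
    proof (intro allI impI)
      fix j assume "j \<le> n"
      then consider "j = 0" | "j = 1" | "j \<in> {2..<n}" | "j = n" by force
      then show "\<epsilon> j \<in> {1, -1}" using plane1(1,2) middle last by cases blast+
    qed
    show "f 1 0 = s 0 \<and> r 1 0 = s 0 * s 1 \<and> (\<forall>k\<in>{2..<n}. deriv (f k) 0 = s k) \<and> r n 0 = s n
              \<longrightarrow> (\<forall>j\<le>n. \<epsilon> j = 1)"
    proof (intro impI allI)
      fix j assume *: "f 1 0 = s 0 \<and> r 1 0 = s 0 * s 1 \<and> (\<forall>k\<in>{2..<n}. deriv (f k) 0 = s k) \<and> r n 0 = s n"
        and "j \<le> n"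
      then consider "j = 0" | "j = 1" | "j \<in> {2..<n}" | "j = n" by force
      then show "\<epsilon> j = 1" using * s_nz[of 0] s_nz[of 1] s_nz[of j] n by cases (auto simp: \<epsilon>_def)
    qed
    show "\<forall>u\<in>valid_domain n D f. \<forall>l<2 * n - 1.
              deformation n f g h u l = quadric_embed (\<lambda>j. \<epsilon> j * quadric n s u j) l"
    proof (intro ballI allI impI)
      fix u l assume u: "u \<in> valid_domain n D f" and l: "l < 2 * n - 1"
      have uD: "u k \<in> D k" if "k \<in> {1..n}" for k using u that by (auto simp: valid_domain_def)
      have C0: "cos_prod n 0 u = cos (u 1) * cos_prod n 1 u" using cos_prod_pred[of 1 n u] n by simp
      consider "l = 0" | "l = 1" | "l \<ge> 2" "l \<noteq> 2 * n - 2" | "l = 2 * n - 2" by force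
      then show "deformation n f g h u l = quadric_embed (\<lambda>j. \<epsilon> j * quadric n s u j) l"
      proof cases
        case 1
        then show ?thesis using plane1(3)[OF uD[OF one_in(2)]] n C0
          by (simp add: deformation_def quadric_embed_def quadric_def Let_def mult_ac)
      next
        case 2
        have "Suc 0 \<noteq> 2 * n - 2" using n by presburger
        then show ?thesis using 2 plane1(4)[OF uD[OF one_in(2)]]
          by (simp add: deformation_def quadric_embed_def quadric_def Let_def mult_ac)
      next
        case 3
        define k where "k = l div 2 + 1"
        have k: "k \<in> {2..<n}" using 3 l by (auto simp: k_def)
        then have uk: "u k \<in> D k" using uD by auto
        have "f k (u k) = \<epsilon> k * (s k * sin (u k))" "g k (u k) = 0"
          using middle[OF k] g0 k uk by auto
        then show ?thesis using 3 k
          by (simp add: deformation_def quadric_embed_def quadric_def Let_def k_def[symmetric] mult_ac del: One_nat_def)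
      next
        case 4
        have "l div 2 + 1 = n" "even l" "\<not> l \<le> 1" using 4 n by auto
        then show ?thesis using 4 last uD[OF n_in] n
          by (simp add: deformation_def quadric_embed_def quadric_def cos_prod_top)
      qed
    qed
  qed
qed

section \<open>All parameters one\<close>

text \<open>
  The defect \<open>sinh w - cos t cosh w\<close> has the logarithmic derivative of \<open>sin\<close>, hence vanishes
  identically once it vanishes at \<open>b\<close>. Then \<open>cosh w\<close> cannot vanish, since \<open>sinh w\<close> would vanish too.
\<close>

lemma artanh_cos_primitive:
  fixes D :: "complex set" and w :: "complex \<Rightarrow> complex"
  assumes D: "open D" "connected D" and b: "b \<in> D"
    and sin0: "\<And>t. t \<in> D \<Longrightarrow> sin t \<noteq> 0"
    and w: "\<And>t. t \<in> D \<Longrightarrow> (w has_field_derivative - 1 / sin t) (at t)"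
    and wb: "sinh (w b) = cos b * cosh (w b)" and t: "t \<in> D"
  shows "cosh (w t) \<noteq> 0" and "tanh (w t) = cos t"
proof -
  define y where "y t = sinh (w t) - cos t * cosh (w t)" for t
  have y': "(y has_field_derivative cos t / sin t * y t) (at t)" if "t \<in> D" for t
  proof -
    have "(y has_field_derivative
        cosh (w t) * (- 1 / sin t) - (- sin t * cosh (w t) + cos t * (sinh (w t) * (- 1 / sin t)))) (at t)"
      unfolding y_def using w[OF that]
      by (auto intro!: derivative_eq_intros simp: algebra_simps)
    moreover have "cosh (w t) * (- 1 / sin t) - (- sin t * cosh (w t) + cos t * (sinh (w t) * (- 1 / sin t))) =
        (- ((1 - (sin t)\<^sup>2) * cosh (w t)) + cos t * sinh (w t)) / sin t"
      using sin0[OF that] by (simp add: field_simps power2_eq_square)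
    moreover have "\<dots> = cos t / sin t * y t"
      unfolding cos_squared_eq[symmetric] by (simp add: y_def power2_eq_square diff_divide_distrib algebra_simps)
    ultimately show ?thesis by (simp only:)
  qed
  have sin': "(sin has_field_derivative cos t / sin t * sin t) (at t)" if "t \<in> D" for t
    using sin0[OF that] by (auto intro!: derivative_eq_intros)
  have yb: "y b = 0 * sin b" using wb by (simp add: y_def)
  have "y t = 0 * sin t"
    by (rule proportional_log_derivatives[OF D y' sin' sin0 b yb t])
  then have y: "sinh (w t) = cos t * cosh (w t)" by (simp add: y_def)
  show "cosh (w t) \<noteq> 0"
    using y cosh_square_eq[of "w t"] by auto
  then show "tanh (w t) = cos t" using y by (simp add: tanh_def)
qed

lemma exists_artanh:
  fixes x :: complex
  assumes "x\<^sup>2 \<noteq> 1"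
  obtains w where "sinh w = x * cosh w" "x = 0 \<longrightarrow> w = 0"
proof
  define w where "w = Ln ((1 + x) / (1 - x)) / 2"
  have x: "1 + x \<noteq> 0" "1 - x \<noteq> 0" using assms by (auto simp: power2_eq_1_iff add_eq_0_iff)
  have "exp w * exp w = (1 + x) / (1 - x)"
    using x by (simp add: w_def exp_add[symmetric])
  then have "exp w * exp w * (1 - x) = 1 + x" using x by simp
  then have "exp w * (exp w * (1 - x)) * exp (- w) = (1 + x) * exp (- w)" by (simp add: mult.assoc)
  then have "exp w * (1 - x) = (1 + x) * exp (- w)"
    by (simp add: exp_minus field_simps)
  then have "exp w - exp (- w) = x * (exp w + exp (- w))" by (simp add: algebra_simps)
  then show "sinh w = x * cosh w" by (simp add: sinh_field_def cosh_field_def)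
  show "x = 0 \<longrightarrow> w = 0" by (simp add: w_def)
qed

text \<open>
  A zero of \<open>sin\<close> would be isolated, and continuity of \<open>\<phi>\<close> there would give \<open>c = 0\<close>. This excludes the
  poles of the integrand of \<open>g\<^sub>k\<close>, at which division by zero yields the value \<open>0\<close>.
\<close>

lemma holomorphic_cosecant_domain:
  fixes c :: complex
  assumes "open D" "\<phi> holomorphic_on D" "c \<noteq> 0"
    and \<phi>: "\<And>t. t \<in> D \<Longrightarrow> sin t \<noteq> 0 \<Longrightarrow> \<phi> t * sin t = c" and t: "t \<in> D"
  shows "sin t \<noteq> 0"
proof
  assume s0: "sin t = 0"
  then have c0: "cos t \<noteq> 0" using sin_cos_squared_add[of t] by auto
  have "\<forall>\<^sub>F x in at t. sin x \<noteq> 0"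
  proof -
    have "((\<lambda>x. (sin x - sin t) / (x - t)) \<longlongrightarrow> cos t) (at t)"
      using DERIV_sin[of t] by (simp add: has_field_derivative_iff)
    then have "\<forall>\<^sub>F x in at t. (sin x - sin t) / (x - t) \<noteq> 0"
      using c0 tendsto_imp_eventually_ne by blast
    then show ?thesis by (rule eventually_mono) (use s0 in auto)
  qed
  moreover have "\<forall>\<^sub>F x in at t. x \<in> D"
    using assms(1) t eventually_at_topological by blast
  ultimately have "\<forall>\<^sub>F x in at t. \<phi> x * sin x = c"
    by eventually_elim (use \<phi> in blast)
  moreover have "isCont (\<lambda>x. \<phi> x * sin x) t"
    using holomorphic_on_imp_continuous_on[OF assms(2)] assms(1) t
    by (intro continuous_intros) (auto simp: continuous_on_eq_continuous_at)
  then have "((\<lambda>x. \<phi> x * sin x) \<longlongrightarrow> 0) (at t)"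
    using s0 by (simp add: isCont_def)
  ultimately have "((\<lambda>x. c) \<longlongrightarrow> 0) (at t)"
    using tendsto_cong by fastforce
  then have "c = 0" using tendsto_const_iff[of "at t" c 0] by simp
  then show False using assms(3) by simp
qed

text \<open>
  For \<open>z\<^sub>k\<^sub>-\<^sub>1 = z\<^sub>k = 1\<close> both radicands are multiples of \<open>sin\<^sup>2\<close> and the integrand of \<open>g\<close> reduces to
  \<open>\<plusminus>s\<^sub>0 / (d sin)\<close>. The branch \<open>w\<close> of \<open>tanh\<^sup>-\<^sup>1 cos\<close> is obtained by rescaling \<open>g\<close> and shifting
  it to the right value at the base point; the shift is \<open>0\<close> at the base point \<open>\<pi>/2\<close>.
\<close>

lemma unit_parameters_angle:
  fixes k :: nat
  assumes D: "open D" "connected D" and par: "par z (k - 1) = 1" "par z k = 1"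
    and nz: "a 0 \<noteq> 0" "d \<noteq> 0" and s0: "s0\<^sup>2 = a 0" and d: "d\<^sup>2 = a k - a 0"
    and r: "sqrt_branch D (g_radicand a z k) r"
    and g: "integral_from b D (\<lambda>t. r t / f_radicand a z k t) g"
  shows "\<exists>w \<sigma> c. w holomorphic_on D \<and> (\<forall>t\<in>D. cosh (w t) \<noteq> 0 \<and> tanh (w t) = cos t) \<and>
    \<sigma> \<in> {1, -1} \<and> (b = of_real pi / 2 \<longrightarrow> c = 0) \<and> (\<forall>t\<in>D. g t = \<sigma> * s0 / d * w t + c)"
proof -
  have s0_nz: "s0 \<noteq> 0" using s0 nz by auto
  have F: "f_radicand a z k t = d\<^sup>2 * (sin t)\<^sup>2" for t
    using par d by (simp add: f_radicand_def)
  have "g_radicand a z k t = (d * s0 * sin t)\<^sup>2" for t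
    using par d s0 by (simp add: g_radicand_def power_mult_distrib)
  then obtain \<eta> where \<eta>: "\<eta> \<in> {1, -1}" "\<And>t. t \<in> D \<Longrightarrow> r t = \<eta> * (d * s0 * sin t)"
    using sine_branch_sign[OF D r] by blast
  have b: "b \<in> D" and hol: "(\<lambda>t. r t / f_radicand a z k t) holomorphic_on D"
    using g by (auto simp: integral_from_def)
  have \<eta>_nz: "\<eta> \<noteq> 0" using \<eta>(1) by auto
  have integrand: "r t / f_radicand a z k t * sin t = \<eta> * s0 / d" if "t \<in> D" "sin t \<noteq> 0" for t
    using \<eta>(2)[OF that(1)] that(2) nz by (simp add: F power2_eq_square)
  have sin_nz: "sin t \<noteq> 0" if "t \<in> D" for t
    by (rule holomorphic_cosecant_domain[OF D(1) hol _ integrand that]) (use \<eta>_nz s0_nz nz in auto)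
  have "(cos b)\<^sup>2 \<noteq> 1" using sin_nz[OF b] by (simp add: cos_squared_eq)
  then obtain w0 where w0: "sinh w0 = cos b * cosh w0" "cos b = 0 \<longrightarrow> w0 = 0"
    by (rule exists_artanh)
  \<comment> \<open>the sign is due to the derivative \<open>- 1 / sin\<close> of \<open>tanh\<^sup>-\<^sup>1 cos\<close>\<close>
  define \<sigma> where "\<sigma> = - \<eta>"
  have \<sigma>: "\<sigma> \<in> {1, -1}" "\<sigma> \<noteq> 0" using \<eta>(1) by (auto simp: \<sigma>_def)
  define w where "w t = g t * d / (\<sigma> * s0) + w0" for t
  have g': "(g has_field_derivative \<eta> * s0 / d / sin t) (at t)" if "t \<in> D" for t
    using integral_from_has_field_derivative[OF g D that] integrand[OF that sin_nz[OF that]] sin_nz[OF that]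
    by (metis nonzero_mult_div_cancel_right)
  have w': "(w has_field_derivative - 1 / sin t) (at t)" if "t \<in> D" for t
  proof -
    have "(w has_field_derivative \<eta> * s0 / d / sin t * d / (\<sigma> * s0)) (at t)"
      unfolding w_def using g'[OF that] \<sigma>(2) s0_nz by (auto intro!: derivative_eq_intros)
    moreover have "\<eta> * s0 / d / sin t * d / (\<sigma> * s0) = - 1 / sin t"
      using sin_nz[OF that] s0_nz nz \<sigma>(2) \<eta>_nz by (simp add: \<sigma>_def)
    ultimately show ?thesis by simp
  qed
  have "w b = w0" using integral_from_base[OF g] by (simp add: w_def)
  then have wb: "sinh (w b) = cos b * cosh (w b)" using w0(1) by simp
  have "w holomorphic_on D" using w' D(1) holomorphic_on_open by blast
  moreover have "\<forall>t\<in>D. cosh (w t) \<noteq> 0 \<and> tanh (w t) = cos t"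
    using artanh_cos_primitive[OF D b sin_nz w' wb] by blast
  moreover have "b = of_real pi / 2 \<longrightarrow> - (\<sigma> * s0 / d * w0) = 0"
  proof
    assume "b = of_real pi / 2"
    then have "b = of_real (pi / 2)" by simp
    then have "cos b = of_real (cos (pi / 2))" by (simp only: cos_of_real)
    then have "cos b = 0" by simp
    then show "- (\<sigma> * s0 / d * w0) = 0" using w0(2) by simp
  qed
  moreover have "\<forall>t\<in>D. g t = \<sigma> * s0 / d * w t + - (\<sigma> * s0 / d * w0)"
    using s0_nz nz \<sigma>(2) by (simp add: w_def distrib_left)
  ultimately show ?thesis using \<sigma>(1) by blast
qed

lemma deformation_plane:
  assumes "k \<in> {1..<n}"
  shows "deformation n f g h u (2 * k - 2) = cos_prod n k u * f k (u k) * cos (g k (u k))"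
    and "deformation n f g h u (2 * k - 1) = cos_prod n k u * f k (u k) * sin (g k (u k))"
proof -
  have "2 * k - 2 \<noteq> 2 * n - 2" "2 * k - 1 \<noteq> 2 * n - 2" "(2 * k - 2) div 2 + 1 = k"
    "(2 * k - 1) div 2 + 1 = k" "even (2 * k - 2)" "odd (2 * k - 1)"
    using assms by (auto; presburger)+
  then show "deformation n f g h u (2 * k - 2) = cos_prod n k u * f k (u k) * cos (g k (u k))"
    and "deformation n f g h u (2 * k - 1) = cos_prod n k u * f k (u k) * sin (g k (u k))"
    by (simp_all only: deformation_def if_False if_True Let_def simp_thms)
qed

lemma par_ones:
  assumes "\<forall>k\<in>{1..<n}. z k = 1" "k \<in> {1..<n}"
  shows "par z (k - 1) = 1" and "par z k = 1"
proof -
  have "k - 1 = 0 \<or> k - 1 \<in> {1..<n}" using assms(2) by auto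
  then show "par z (k - 1) = 1" and "par z k = 1" using assms by (auto simp: par_def)
qed

section \<open>The deformation theorem\<close>

theorem theorem1:
  fixes n :: nat and a s :: "nat \<Rightarrow> complex"
  assumes "n \<ge> 2"
    and "\<forall>j\<le>n. a j \<noteq> 0"
    and "inj_on a {..n}"
    and "\<forall>j\<le>n. (s j)\<^sup>2 = a j"
  shows
    \<comment> \<open>same linear element\<close>
    "(\<forall>z b D f r g h. branches n a z b D f r g h \<longrightarrow>
        (\<forall>u\<in>valid_domain n D f. \<forall>v.
           lin_element (n + 1) n (quadric n s) u v
             = lin_element (2 * n - 1) n (deformation n f g h) u v)) \<and>
    \<comment> \<open>\<open>z = 0\<close>: the quadric itself, up to the signs of the chosen roots\<close>
     (\<forall>z b D f r g h. branches n a z b D f r g h \<and>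
          (\<forall>k\<in>{1..<n}. z k = 0) \<and> (\<forall>k\<in>{1..<n}. b k = 0) \<longrightarrow>
        (\<forall>k\<in>{2..<n}. \<forall>t\<in>D k. g k t = 0) \<and>
        (\<exists>\<epsilon>. (\<forall>j\<le>n. \<epsilon> j \<in> {1, -1}) \<and>
           (f 1 0 = s 0 \<and> r 1 0 = s 0 * s 1 \<and> (\<forall>k\<in>{2..<n}. deriv (f k) 0 = s k) \<and> r n 0 = s n
              \<longrightarrow> (\<forall>j\<le>n. \<epsilon> j = 1)) \<and>
           (\<forall>u\<in>valid_domain n D f. \<forall>l<2 * n - 1.
              deformation n f g h u l = quadric_embed (\<lambda>j. \<epsilon> j * quadric n s u j) l))) \<and>
    \<comment> \<open>\<open>z = (1, \<dots>, 1)\<close>: Peterson's formulae\<close>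
     (\<forall>z b D f r g h d. branches n a z b D f r g h \<and>
          (\<forall>k\<in>{1..<n}. z k = 1) \<and> (\<forall>k\<in>{1..<n}. (d k)\<^sup>2 = a k - a 0) \<longrightarrow>
        (\<forall>k\<in>{1..<n}.
           (\<forall>u\<in>valid_domain n D f.
              (d k * cos_prod n k u * sin (u k))\<^sup>2
                = (deformation n f g h u (2 * k - 2))\<^sup>2 + (deformation n f g h u (2 * k - 1))\<^sup>2) \<and>
           (\<exists>w \<sigma> c. w holomorphic_on D k \<and>
              (\<forall>t\<in>D k. cosh (w t) \<noteq> 0 \<and> tanh (w t) = cos t) \<and>
              \<sigma> \<in> {1, -1} \<and> (b k = of_real pi / 2 \<longrightarrow> c = 0) \<and>
              (\<forall>u\<in>valid_domain n D f. deformation n f g h u (2 * k - 2) \<noteq> 0 \<longrightarrow>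
                 cos (\<sigma> * s 0 / d k * w (u k) + c) \<noteq> 0 \<and>
                 tan (\<sigma> * s 0 / d k * w (u k) + c)
                   = deformation n f g h u (2 * k - 1) / deformation n f g h u (2 * k - 2)))) \<and>
        (\<exists>q H. sqrt_branch (D n) (\<lambda>t. a n - (a n - a 0) * (sin t)\<^sup>2) q \<and>
           integral_from 0 (D n) q H \<and>
           (\<forall>u\<in>valid_domain n D f. deformation n f g h u (2 * n - 2) = H (u n)))) \<and>
    \<comment> \<open>conjugate system: no mixed terms in the joined second fundamental forms\<close>
     (\<forall>z b D f r g h. branches n a z b D f r g h \<longrightarrow>
        (\<forall>u\<in>valid_domain n D f. \<forall>N NY.
           immersed_at (n + 1) n (quadric n s) u \<and>
           immersed_at (2 * n - 1) n (deformation n f g h) u \<and>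
           normal_data n (quadric n s) (deformation n f g h) u N NY \<longrightarrow>
           (\<forall>i\<in>{1..n}. \<forall>j\<in>{1..n}. i \<noteq> j \<longrightarrow>
              (\<forall>k<n. joined_form n (quadric n s) (deformation n f g h) u N NY i j k = 0)))) \<and>
    \<comment> \<open>non-degeneracy: the coefficients of \<open>(du\<^sup>j)\<^sup>2\<close> are linearly independent in \<open>\<complex>\<^sup>n\<close>\<close>
     (\<exists>Z. openin (param_space n) Z \<and> param_space n closure_of Z = topspace (param_space n) \<and>
        (\<forall>z\<in>Z. \<forall>b D f r g h. branches n a z b D f r g h \<longrightarrow>
          (\<forall>u\<in>valid_domain n D f. \<forall>N NY.
             nondegenerate_metric_at (n + 1) n (quadric n s) u \<and>
             normal_data n (quadric n s) (deformation n f g h) u N NY \<longrightarrow>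
             lin_indep {1..n} {..<n}
               (\<lambda>j. joined_form n (quadric n s) (deformation n f g h) u N NY j j))))"
proof (intro conjI)
  note n = assms(1) and nz = assms(2) and inj = assms(3) and s = assms(4)
  show "\<forall>z b D f r g h. branches n a z b D f r g h \<longrightarrow>
        (\<forall>u\<in>valid_domain n D f. \<forall>v.
           lin_element (n + 1) n (quadric n s) u v
             = lin_element (2 * n - 1) n (deformation n f g h) u v)"
  proof (intro allI impI ballI)
    fix z b D f r g h u v
    assume br: "branches n a z b D f r g h" and u: "u \<in> valid_domain n D f"
    note X = quadric_profiled[OF n s, of u] and Y = deformation_profiled[OF n br u]
    have "(\<lambda>k. if k = 0 then a 0 else 0) 0 = branch_param a z 0" by (simp add: branch_param_def par_def)
    from profiled_maps_isometric[OF X Y this, of v v]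
    show "lin_element (n + 1) n (quadric n s) u v = lin_element (2 * n - 1) n (deformation n f g h) u v"
      by (simp only: warped_map.lin_element_along[OF profiled_map.axioms(1)[OF X]]
          warped_map.lin_element_along[OF profiled_map.axioms(1)[OF Y]])
  qed
  show "\<forall>z b D f r g h. branches n a z b D f r g h \<and>
          (\<forall>k\<in>{1..<n}. z k = 0) \<and> (\<forall>k\<in>{1..<n}. b k = 0) \<longrightarrow>
        (\<forall>k\<in>{2..<n}. \<forall>t\<in>D k. g k t = 0) \<and>
        (\<exists>\<epsilon>. (\<forall>j\<le>n. \<epsilon> j \<in> {1, -1}) \<and>
           (f 1 0 = s 0 \<and> r 1 0 = s 0 * s 1 \<and> (\<forall>k\<in>{2..<n}. deriv (f k) 0 = s k) \<and> r n 0 = s n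
              \<longrightarrow> (\<forall>j\<le>n. \<epsilon> j = 1)) \<and>
           (\<forall>u\<in>valid_domain n D f. \<forall>l<2 * n - 1.
              deformation n f g h u l = quadric_embed (\<lambda>j. \<epsilon> j * quadric n s u j) l))"
  proof (intro allI impI)
    fix z b D f r g h
    assume *: "branches n a z b D f r g h \<and> (\<forall>k\<in>{1..<n}. z k = 0) \<and> (\<forall>k\<in>{1..<n}. b k = 0)"
    show "(\<forall>k\<in>{2..<n}. \<forall>t\<in>D k. g k t = 0) \<and>
        (\<exists>\<epsilon>. (\<forall>j\<le>n. \<epsilon> j \<in> {1, -1}) \<and>
           (f 1 0 = s 0 \<and> r 1 0 = s 0 * s 1 \<and> (\<forall>k\<in>{2..<n}. deriv (f k) 0 = s k) \<and> r n 0 = s n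
              \<longrightarrow> (\<forall>j\<le>n. \<epsilon> j = 1)) \<and>
           (\<forall>u\<in>valid_domain n D f. \<forall>l<2 * n - 1.
              deformation n f g h u l = quadric_embed (\<lambda>j. \<epsilon> j * quadric n s u j) l))"
      using * by (intro conjI zero_parameters_quadric[OF n nz s]) auto
  qed
  show "\<forall>z b D f r g h d. branches n a z b D f r g h \<and>
          (\<forall>k\<in>{1..<n}. z k = 1) \<and> (\<forall>k\<in>{1..<n}. (d k)\<^sup>2 = a k - a 0) \<longrightarrow>
        (\<forall>k\<in>{1..<n}.
           (\<forall>u\<in>valid_domain n D f.
              (d k * cos_prod n k u * sin (u k))\<^sup>2
                = (deformation n f g h u (2 * k - 2))\<^sup>2 + (deformation n f g h u (2 * k - 1))\<^sup>2) \<and>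
           (\<exists>w \<sigma> c. w holomorphic_on D k \<and>
              (\<forall>t\<in>D k. cosh (w t) \<noteq> 0 \<and> tanh (w t) = cos t) \<and>
              \<sigma> \<in> {1, -1} \<and> (b k = of_real pi / 2 \<longrightarrow> c = 0) \<and>
              (\<forall>u\<in>valid_domain n D f. deformation n f g h u (2 * k - 2) \<noteq> 0 \<longrightarrow>
                 cos (\<sigma> * s 0 / d k * w (u k) + c) \<noteq> 0 \<and>
                 tan (\<sigma> * s 0 / d k * w (u k) + c)
                   = deformation n f g h u (2 * k - 1) / deformation n f g h u (2 * k - 2)))) \<and>
        (\<exists>q H. sqrt_branch (D n) (\<lambda>t. a n - (a n - a 0) * (sin t)\<^sup>2) q \<and>
           integral_from 0 (D n) q H \<and>
           (\<forall>u\<in>valid_domain n D f. deformation n f g h u (2 * n - 2) = H (u n)))"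
  proof (intro allI impI conjI ballI)
    fix z b D f r g h d k u
    assume *: "branches n a z b D f r g h \<and> (\<forall>k\<in>{1..<n}. z k = 1) \<and> (\<forall>k\<in>{1..<n}. (d k)\<^sup>2 = a k - a 0)"
      and k: "k \<in> {1..<n}" and u: "u \<in> valid_domain n D f"
    have "par z (k - 1) = 1" "par z k = 1" using par_ones[OF _ k, of z] * by auto
    then have "f_radicand a z k t = (d k * sin t)\<^sup>2" for t
      using * k by (simp add: f_radicand_def power_mult_distrib)
    moreover have "(f k (u k))\<^sup>2 = f_radicand a z k (u k)"
      using * k u by (auto simp: branches_def sqrt_branch_def valid_domain_def)
    ultimately have "(f k (u k))\<^sup>2 = (d k * sin (u k))\<^sup>2" by simp
    then show "(d k * cos_prod n k u * sin (u k))\<^sup>2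
        = (deformation n f g h u (2 * k - 2))\<^sup>2 + (deformation n f g h u (2 * k - 1))\<^sup>2"
      unfolding deformation_plane[OF k] by (simp add: power_mult_distrib mult_ac flip: distrib_left)
  next
    fix z b D f r g h d k
    assume *: "branches n a z b D f r g h \<and> (\<forall>k\<in>{1..<n}. z k = 1) \<and> (\<forall>k\<in>{1..<n}. (d k)\<^sup>2 = a k - a 0)"
      and k: "k \<in> {1..<n}"
    have "a k \<noteq> a 0" using inj_onD[OF inj, of k 0] k by auto
    then have d: "d k \<noteq> 0" using * k by fastforce
    have "\<exists>w \<sigma> c. w holomorphic_on D k \<and> (\<forall>t\<in>D k. cosh (w t) \<noteq> 0 \<and> tanh (w t) = cos t) \<and>
        \<sigma> \<in> {1, -1} \<and> (b k = of_real pi / 2 \<longrightarrow> c = 0) \<and> (\<forall>t\<in>D k. g k t = \<sigma> * s 0 / d k * w t + c)"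
      by (rule unit_parameters_angle[where r = "r k" and k = k])
         (use * k nz s d par_ones[OF _ k, of z] in \<open>auto simp: branches_def\<close>)
    then obtain w \<sigma> c where w: "w holomorphic_on D k" "\<forall>t\<in>D k. cosh (w t) \<noteq> 0 \<and> tanh (w t) = cos t"
        "\<sigma> \<in> {1, -1}" "b k = of_real pi / 2 \<longrightarrow> c = 0" "\<forall>t\<in>D k. g k t = \<sigma> * s 0 / d k * w t + c"
      by blast
    have "\<forall>u\<in>valid_domain n D f. deformation n f g h u (2 * k - 2) \<noteq> 0 \<longrightarrow>
        cos (\<sigma> * s 0 / d k * w (u k) + c) \<noteq> 0 \<and>
        tan (\<sigma> * s 0 / d k * w (u k) + c)
          = deformation n f g h u (2 * k - 1) / deformation n f g h u (2 * k - 2)"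
    proof (intro ballI impI)
      fix u assume u: "u \<in> valid_domain n D f" and nonzero: "deformation n f g h u (2 * k - 2) \<noteq> 0"
      have "u k \<in> D k" using u k by (auto simp: valid_domain_def)
      then have angle: "\<sigma> * s 0 / d k * w (u k) + c = g k (u k)" using w(5) by simp
      show "cos (\<sigma> * s 0 / d k * w (u k) + c) \<noteq> 0 \<and>
        tan (\<sigma> * s 0 / d k * w (u k) + c)
          = deformation n f g h u (2 * k - 1) / deformation n f g h u (2 * k - 2)"
        using nonzero unfolding angle deformation_plane[OF k] by (simp add: tan_def)
    qed
    with w(1-4) show "\<exists>w \<sigma> c. w holomorphic_on D k \<and>
              (\<forall>t\<in>D k. cosh (w t) \<noteq> 0 \<and> tanh (w t) = cos t) \<and>
              \<sigma> \<in> {1, -1} \<and> (b k = of_real pi / 2 \<longrightarrow> c = 0) \<and>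
              (\<forall>u\<in>valid_domain n D f. deformation n f g h u (2 * k - 2) \<noteq> 0 \<longrightarrow>
                 cos (\<sigma> * s 0 / d k * w (u k) + c) \<noteq> 0 \<and>
                 tan (\<sigma> * s 0 / d k * w (u k) + c)
                   = deformation n f g h u (2 * k - 1) / deformation n f g h u (2 * k - 2))"
      by (intro exI[of _ w] exI[of _ \<sigma>] exI[of _ c] conjI)
  next
    fix z b D f r g h d
    assume *: "branches n a z b D f r g h \<and> (\<forall>k\<in>{1..<n}. z k = 1) \<and> (\<forall>k\<in>{1..<n}. (d k)\<^sup>2 = a k - a 0)"
    have "par z (n - 1) = 1" using * n by (simp add: par_def)
    then have "h_radicand n a z = (\<lambda>t. a n - (a n - a 0) * (sin t)\<^sup>2)" by (auto simp: h_radicand_def)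
    then show "\<exists>q H. sqrt_branch (D n) (\<lambda>t. a n - (a n - a 0) * (sin t)\<^sup>2) q \<and>
           integral_from 0 (D n) q H \<and>
           (\<forall>u\<in>valid_domain n D f. deformation n f g h u (2 * n - 2) = H (u n))"
      using * by (intro exI[of _ "r n"] exI[of _ h]) (auto simp: branches_def deformation_def)
  qed
  show "\<forall>z b D f r g h. branches n a z b D f r g h \<longrightarrow>
        (\<forall>u\<in>valid_domain n D f. \<forall>N NY.
           immersed_at (n + 1) n (quadric n s) u \<and>
           immersed_at (2 * n - 1) n (deformation n f g h) u \<and>
           normal_data n (quadric n s) (deformation n f g h) u N NY \<longrightarrow>
           (\<forall>i\<in>{1..n}. \<forall>j\<in>{1..n}. i \<noteq> j \<longrightarrow>
              (\<forall>k<n. joined_form n (quadric n s) (deformation n f g h) u N NY i j k = 0)))"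
  proof (intro allI impI ballI)
    fix z b D f r g h u N NY i j k
    assume br: "branches n a z b D f r g h" and u: "u \<in> valid_domain n D f"
      and *: "immersed_at (n + 1) n (quadric n s) u \<and>
           immersed_at (2 * n - 1) n (deformation n f g h) u \<and>
           normal_data n (quadric n s) (deformation n f g h) u N NY"
      and ij: "i \<in> {1..n}" "j \<in> {1..n}" "i \<noteq> j" and k: "k < n"
    interpret X: warped_map n "n + 1" "max 1" "quadric_profile s" "quadric n s" u
      by (rule quadric_warped[OF n])
    interpret Y: warped_map n "2 * n - 1" "\<lambda>l. l div 2 + 1" "deformation_profile n f g h" "deformation n f g h" u
      by (rule profiled_map.axioms(1)[OF deformation_profiled[OF n br u]])
    have cos: "cos (u q) \<noteq> 0" if "p \<in> {1..n}" "q \<in> {1..n}" "p < q" for p q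
      using X.immersed_cos_nonzero[OF _ that] * by blast
    have N: "normal_at (n + 1) n (quadric n s) u N"
      and NY: "k \<noteq> 0 \<Longrightarrow> normal_at (2 * n - 1) n (deformation n f g h) u (NY k)"
      using * k by (auto simp: normal_data_def)
    show "joined_form n (quadric n s) (deformation n f g h) u N NY i j k = 0"
    proof (cases "i < j")
      case True
      show ?thesis
        unfolding joined_form_def
        using X.second_form_mixed_zero(1)[OF N cos ij(1,2) True] Y.second_form_mixed_zero(1)[OF NY cos ij(1,2) True]
          ij True by auto
    next
      case False
      then have ji: "j < i" using ij by simp
      show ?thesis
        unfolding joined_form_def
        using X.second_form_mixed_zero(2)[OF N cos ij(2,1) ji] Y.second_form_mixed_zero(2)[OF NY cos ij(2,1) ji]
          ij ji by auto
    qed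
  qed
  show "\<exists>Z. openin (param_space n) Z \<and> param_space n closure_of Z = topspace (param_space n) \<and>
        (\<forall>z\<in>Z. \<forall>b D f r g h. branches n a z b D f r g h \<longrightarrow>
          (\<forall>u\<in>valid_domain n D f. \<forall>N NY.
             nondegenerate_metric_at (n + 1) n (quadric n s) u \<and>
             normal_data n (quadric n s) (deformation n f g h) u N NY \<longrightarrow>
             lin_indep {1..n} {..<n}
               (\<lambda>j. joined_form n (quadric n s) (deformation n f g h) u N NY j j)))"
  proof (intro exI[of _ "PiE {1..<n} (\<lambda>_. - {0 :: complex})"] conjI generic_parameters_open_dense
      ballI allI impI)
    fix z b D f r g h u N NY
    assume z: "z \<in> PiE {1..<n} (\<lambda>_. - {0 :: complex})" and br: "branches n a z b D f r g h"
      and u: "u \<in> valid_domain n D f"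
      and *: "nondegenerate_metric_at (n + 1) n (quadric n s) u \<and>
             normal_data n (quadric n s) (deformation n f g h) u N NY"
    have "branch_param a z k \<noteq> 0" if "k \<in> {1..<n}" for k
      using PiE_mem[OF z that] nz that by (simp add: branch_param_def par_def)
    then show "lin_indep {1..n} {..<n}
               (\<lambda>j. joined_form n (quadric n s) (deformation n f g h) u N NY j j)"
      using * by (intro joined_form_nondegenerate[OF n s nz deformation_profiled[OF n br u]])
        (auto simp: branch_param_def par_def)
  qed
qed

end
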